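(* Every morphism $f\colon(\Lambda,\mathscr{L})\to(\Gamma,\mathscr{G})$ of graphs of groups factors into a composition of collapse moves followed by a Stallings morphism. The collapse moves proceed by collapsing each component of each preimage $f^{-1}(v)$ as $v$ varies over the vertices of $\Gamma$, followed by collapsing the resulting morphism to $(\Gamma,\mathscr{G})$ onto its image.
   Context: A graph of groups $(\Gamma,\mathscr{G})$ is a connected graph with vertex groups $\mathscr{G}_v$, edge groups $\mathscr{G}_e=\mathscr{G}_{\bar e}$ and monomorphisms $\iota_e\colon\mathscr{G}_e\to\mathscr{G}_{\tau(e)}$ ($\tau(e)$ the terminal vertex of the oriented edge $e$, $\bar e$ its reverse). A path in $(\Gamma,\mathscr{G})$ is an edge path in $\Gamma$ (whose first and last terms may be segments of edges or empty) with elements of the corresponding vertex groups inserted at the vertices it meets; homotopy rel endpoints is generated by inserting or deleting $\sigma\bar\sigma$ and replacing $g\,e\,\iota_e(h)\,g'$ by $g\,\iota_{\bar e}(h)\,e\,g'$, $h\in\mathscr{G}_e$; $\pi_1(\Gamma,\mathscr{G},p)$ is the group of homotopy classes of loops at $p$. A morphism $f\colon(\Lambda,\mathscr{L})\to(\Gamma,\mathscr{G})$ is a graph map (vertices to vertices, edges to edges or collapsed to vertices), homomorphisms $f_v\colon\mathscr{L}_v\to\mathscr{G}_{f(v)}$, $f_e\colon\mathscr{L}_e\to\mathscr{G}_{f(e)}$, and for each oriented edge $e$ an element $\delta_e\in\mathscr{G}_{f(\tau(e))}$ with $f_{\tau(e)}(\iota_e(h))=\delta_e\iota_{f(e)}(f_e(h))\delta_e^{-1}$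 for $h\in\mathscr{L}_e$ ($\iota_{f(e)}$ the identity if $e$ is collapsed). A morphism is Stallings if it collapses no edges and every $f_v$ and $f_e$ is a monomorphism. Collapse moves. (a) Collapsing a nonempty connected subgraph $\Lambda_0\subset\Lambda$: the graph becomes $\Lambda/\Lambda_0$; the vertex $\Lambda_0$ has vertex group $\pi_1(\Lambda_0,\mathscr{L}|_{\Lambda_0})$, where $\mathscr{L}|_{\Lambda_0}$ is the restriction of $\mathscr{L}$; other vertex and edge groups are unchanged; for an edge $e$ not in $\Lambda_0$ with $\tau(e)\in\Lambda_0$, $\iota_e$ is replaced by its composite with $\mathscr{L}_{\tau(e)}\hookrightarrow\pi_1(\Lambda_0,\mathscr{L}|_{\Lambda_0})$, and the other monomorphisms are unchanged. Disconnected subgraphs are collapsed component by component (if $\Lambda$ is infinite, the sequence of collapses need not be finite; the collapses form a directed system, of which one can take the direct limit). (b) Collapsing a morphism $f\colon(\Lambda,\mathscr{L})\to(\Gamma,\mathscr{G})$ that collapses no edges onto its image, i.e. collapsing $\mathscr{L}$ to its image $f(\mathscr{L})$: replace $\mathscr{L}$ by the structure $f(\mathscr{L})$ on $\Lambda$ with $f(\mathscr{L})_x=f_x(\mathscr{L}_x)\le\mathscr{G}_{f(x)}$ for each vertex or edge $x$, and with $\iota_e\colon f(\mathscr{L})_e\to f(\mathscr{L})_{\tau(e)}$ given by $h\mapsto\delta_e\,\iota_{f(e)}(h)\,\delta_e^{-1}$; the collapse morphism $(\Lambda,\mathscr{L})\to(\Lambda,f(\mathscr{L}))$ is the identity on $\Lambda$,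 acts as $f$ on vertex and edge groups, and has trivial elements $\delta_e$.
   Formalization: The morphism equals the composition of collapse moves and a Stallings morphism only up to conjugation at vertices by the images of chosen paths in the fibres (and at collapsed edges by a group element), since strict equality can fail; the factorization of the resulting morphism is strict. *)

theory Defs
  imports "HOL-Algebra.Coset" "HOL-Combinatorics.Orbits"
    "Graph_Theory.Digraph_Component" "Graph_Theory.Bidirected_Digraph"
begin

text \<open>
  Graphs are graphs in the sense of Serre: a directed multigraph, possibly infinite, with a
  fixed-point-free reversal of its arcs. The terminal vertex \<open>\<tau>(e)\<close> is \<^term>\<open>head\<close>.
  Vertex group elements, and edge group elements, of all vertices and all edges live in one type
  each; this is no restriction, as the groups themselves depend on the vertex or edge.
\<close>

record ('v, 'e, 'g, 'h) gog =
  gr :: "('v, 'e) pre_digraph"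
  arev :: "'e \<Rightarrow> 'e"
  vgrp :: "'v \<Rightarrow> 'g monoid"
  egrp :: "'e \<Rightarrow> 'h monoid"
  inc :: "'e \<Rightarrow> 'h \<Rightarrow> 'g"

locale graph_of_groups =
  bidirected_digraph "gr \<G>" "arev \<G>" for \<G> :: "('v, 'e, 'g, 'h) gog" +
  assumes connected: "connected (gr \<G>)"
    and vgrp_group: "v \<in> verts (gr \<G>) \<Longrightarrow> group (vgrp \<G> v)"
    and egrp_group: "e \<in> arcs (gr \<G>) \<Longrightarrow> group (egrp \<G> e)"
    and egrp_arev: "e \<in> arcs (gr \<G>) \<Longrightarrow> egrp \<G> (arev \<G> e) = egrp \<G> e"
    and inc_mon: "e \<in> arcs (gr \<G>) \<Longrightarrow> inc \<G> e \<in> mon (egrp \<G> e) (vgrp \<G> (head (gr \<G>) e))"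

text \<open>The reversal is the identity off the arcs, as \<^locale>\<open>bidirected_digraph\<close> demands.\<close>

definition restrict_gog ::
  "('v, 'e, 'g, 'h) gog \<Rightarrow> ('v, 'e) pre_digraph \<Rightarrow> ('v, 'e, 'g, 'h) gog" where
  "restrict_gog \<G> H = \<G>\<lparr>gr := H, arev := perm_restrict (arev \<G>) (arcs H)\<rparr>"


section \<open>Paths, homotopy, the fundamental group\<close>

text \<open>
  \<open>(g\<^sub>0, [(e\<^sub>1, g\<^sub>1), \<dots>, (e\<^sub>n, g\<^sub>n)])\<close> is the path \<open>g\<^sub>0 e\<^sub>1 g\<^sub>1 \<dots> e\<^sub>n g\<^sub>n\<close> between vertices: consecutive
  group elements at a vertex are multiplied, absent ones are \<open>\<one>\<close>.
\<close>

type_synonym ('g, 'e) gpath = "'g \<times> ('e \<times> 'g) list"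

fun is_path :: "('v, 'e, 'g, 'h) gog \<Rightarrow> 'v \<Rightarrow> ('g, 'e) gpath \<Rightarrow> 'v \<Rightarrow> bool" where
  "is_path \<G> u (g, []) v \<longleftrightarrow> u = v \<and> u \<in> verts (gr \<G>) \<and> g \<in> carrier (vgrp \<G> u)"
| "is_path \<G> u (g, (e, k) # s) v \<longleftrightarrow>
     e \<in> arcs (gr \<G>) \<and> tail (gr \<G>) e = u \<and> g \<in> carrier (vgrp \<G> u) \<and>
     is_path \<G> (head (gr \<G>) e) (k, s) v"

text \<open>In \<^term>\<open>path_cat\<close> and \<^term>\<open>path_rev\<close>, the vertex is the initial vertex of the (first) path.\<close>

fun path_cat ::
  "('v, 'e, 'g, 'h) gog \<Rightarrow> 'v \<Rightarrow> ('g, 'e) gpath \<Rightarrow> ('g, 'e) gpath \<Rightarrow> ('g, 'e) gpath" where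
  "path_cat \<G> u (g, []) (g', t) = (g \<otimes>\<^bsub>vgrp \<G> u\<^esub> g', t)"
| "path_cat \<G> u (g, (e, k) # s) q =
     (let (k', r) = path_cat \<G> (head (gr \<G>) e) (k, s) q in (g, (e, k') # r))"

fun path_rev :: "('v, 'e, 'g, 'h) gog \<Rightarrow> 'v \<Rightarrow> ('g, 'e) gpath \<Rightarrow> ('g, 'e) gpath" where
  "path_rev \<G> u (g, []) = (inv\<^bsub>vgrp \<G> u\<^esub> g, [])"
| "path_rev \<G> u (g, (e, k) # s) =
     (let (k', r) = path_rev \<G> (head (gr \<G>) e) (k, s)
      in (k', r @ [(arev \<G> e, inv\<^bsub>vgrp \<G> u\<^esub> g)]))"

inductive homotopic ::
  "('v, 'e, 'g, 'h) gog \<Rightarrow> 'v \<Rightarrow> 'v \<Rightarrow> ('g, 'e) gpath \<Rightarrow> ('g, 'e) gpath \<Rightarrow> bool" for \<G> where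
  refl: "is_path \<G> u p v \<Longrightarrow> homotopic \<G> u v p p"
| sym: "homotopic \<G> u v p q \<Longrightarrow> homotopic \<G> u v q p"
| trans: "homotopic \<G> u v p q \<Longrightarrow> homotopic \<G> u v q r \<Longrightarrow> homotopic \<G> u v p r"
| backtrack:
    "is_path \<G> u \<alpha> w \<Longrightarrow> is_path \<G> w \<sigma> x \<Longrightarrow> is_path \<G> w \<beta> v \<Longrightarrow>
     homotopic \<G> u v
       (path_cat \<G> u \<alpha> \<beta>)
       (path_cat \<G> u \<alpha> (path_cat \<G> w \<sigma> (path_cat \<G> x (path_rev \<G> w \<sigma>) \<beta>)))"
| slide:
    "e \<in> arcs (gr \<G>) \<Longrightarrow> w = tail (gr \<G>) e \<Longrightarrow> x = head (gr \<G>) e \<Longrightarrow>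
     h \<in> carrier (egrp \<G> e) \<Longrightarrow> is_path \<G> u \<alpha> w \<Longrightarrow> is_path \<G> x \<beta> v \<Longrightarrow>
     homotopic \<G> u v
       (path_cat \<G> u \<alpha> (path_cat \<G> w (\<one>\<^bsub>vgrp \<G> w\<^esub>, [(e, inc \<G> e h)]) \<beta>))
       (path_cat \<G> u \<alpha> (path_cat \<G> w (inc \<G> (arev \<G> e) h, [(e, \<one>\<^bsub>vgrp \<G> x\<^esub>)]) \<beta>))"

definition loop_class :: "('v, 'e, 'g, 'h) gog \<Rightarrow> 'v \<Rightarrow> ('g, 'e) gpath \<Rightarrow> ('g, 'e) gpath set" where
  "loop_class \<G> b p = {q. homotopic \<G> b b p q}"

definition pi1 :: "('v, 'e, 'g, 'h) gog \<Rightarrow> 'v \<Rightarrow> ('g, 'e) gpath set monoid" where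
  "pi1 \<G> b =
     \<lparr>carrier = loop_class \<G> b ` {p. is_path \<G> b p b},
      monoid.mult = (\<lambda>X Y. \<Union>p\<in>X. \<Union>q\<in>Y. loop_class \<G> b (path_cat \<G> b p q)),
      one = loop_class \<G> b (\<one>\<^bsub>vgrp \<G> b\<^esub>, [])\<rparr>"


section \<open>Morphisms\<close>

text \<open>
  \<open>emap e\<close> is an edge \<open>Inl e'\<close>, or the vertex \<open>Inr w\<close> to which \<open>e\<close> is collapsed. The homomorphism
  \<open>f\<^sub>e\<close> is \<open>ehom e\<close> in the first case and \<open>chom e\<close>, with values in a vertex group, in the second;
  the other one of the two is irrelevant.
\<close>

record ('v, 'e, 'g, 'h, 'w, 'd, 'k, 'l) gog_map =
  vmap :: "'v \<Rightarrow> 'w"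
  emap :: "'e \<Rightarrow> 'd + 'w"
  vhom :: "'v \<Rightarrow> 'g \<Rightarrow> 'k"
  ehom :: "'e \<Rightarrow> 'h \<Rightarrow> 'l"
  chom :: "'e \<Rightarrow> 'h \<Rightarrow> 'k"
  delta :: "'e \<Rightarrow> 'k"

definition gog_morphism ::
  "('v, 'e, 'g, 'h) gog \<Rightarrow> ('w, 'd, 'k, 'l) gog \<Rightarrow>
   ('v, 'e, 'g, 'h, 'w, 'd, 'k, 'l) gog_map \<Rightarrow> bool" where
  "gog_morphism \<L> \<G> f \<longleftrightarrow>
     (\<forall>v\<in>verts (gr \<L>).
        vmap f v \<in> verts (gr \<G>) \<and> vhom f v \<in> hom (vgrp \<L> v) (vgrp \<G> (vmap f v))) \<and>
     (\<forall>e\<in>arcs (gr \<L>).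
        let x = head (gr \<L>) e; V = vgrp \<G> (vmap f x) in
        delta f e \<in> carrier V \<and>
        (case emap f e of
           Inl e' \<Rightarrow>
             e' \<in> arcs (gr \<G>) \<and> head (gr \<G>) e' = vmap f x \<and>
             emap f (arev \<L> e) = Inl (arev \<G> e') \<and>
             ehom f e \<in> hom (egrp \<L> e) (egrp \<G> e') \<and>
             (\<forall>h\<in>carrier (egrp \<L> e).
                ehom f (arev \<L> e) h = ehom f e h \<and>
                vhom f x (inc \<L> e h) =
                  delta f e \<otimes>\<^bsub>V\<^esub> inc \<G> e' (ehom f e h) \<otimes>\<^bsub>V\<^esub> inv\<^bsub>V\<^esub> (delta f e))
         | Inr w \<Rightarrow>
             w = vmap f x \<and> emap f (arev \<L> e) = Inr w \<and>
             chom f e \<in> hom (egrp \<L> e) (vgrp \<G> w) \<and>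
             (\<forall>h\<in>carrier (egrp \<L> e).
                chom f (arev \<L> e) h = chom f e h \<and>
                vhom f x (inc \<L> e h) =
                  delta f e \<otimes>\<^bsub>V\<^esub> chom f e h \<otimes>\<^bsub>V\<^esub> inv\<^bsub>V\<^esub> (delta f e))))"

definition collapses_no_edge ::
  "('v, 'e, 'g, 'h) gog \<Rightarrow> ('v, 'e, 'g, 'h, 'w, 'd, 'k, 'l) gog_map \<Rightarrow> bool" where
  "collapses_no_edge \<L> f \<longleftrightarrow> (\<forall>e\<in>arcs (gr \<L>). isl (emap f e))"

definition stallings ::
  "('v, 'e, 'g, 'h) gog \<Rightarrow> ('w, 'd, 'k, 'l) gog \<Rightarrow>
   ('v, 'e, 'g, 'h, 'w, 'd, 'k, 'l) gog_map \<Rightarrow> bool" where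
  "stallings \<L> \<G> f \<longleftrightarrow>
     gog_morphism \<L> \<G> f \<and> collapses_no_edge \<L> f \<and>
     (\<forall>v\<in>verts (gr \<L>). vhom f v \<in> mon (vgrp \<L> v) (vgrp \<G> (vmap f v))) \<and>
     (\<forall>e\<in>arcs (gr \<L>). ehom f e \<in> mon (egrp \<L> e) (egrp \<G> (projl (emap f e))))"

text \<open>
  The element of a composite \<open>f'' \<circ> f'\<close> at \<open>e\<close> is \<open>f''(\<delta>'\<^sub>e) \<delta>''\<^sub>e\<^sub>'\<close> if \<open>f'(e)\<close> is an edge \<open>e'\<close>, and
  \<open>f''(\<delta>'\<^sub>e)\<close> if \<open>f'\<close> collapses \<open>e\<close>: substitute one defining equation into the other.
  The arguments \<open>\<L>\<close> and \<open>\<N>\<close> are the source of \<open>f'\<close> and the target of \<open>f''\<close>.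
\<close>

definition gog_comp ::
  "('v, 'e, 'g, 'h) gog \<Rightarrow> ('z, 'c, 'm, 'n) gog \<Rightarrow>
   ('w, 'd, 'k, 'l, 'z, 'c, 'm, 'n) gog_map \<Rightarrow> ('v, 'e, 'g, 'h, 'w, 'd, 'k, 'l) gog_map \<Rightarrow>
   ('v, 'e, 'g, 'h, 'z, 'c, 'm, 'n) gog_map" where
  "gog_comp \<L> \<N> f'' f' =
     \<lparr>vmap = (\<lambda>v. vmap f'' (vmap f' v)),
      emap = (\<lambda>e. case emap f' e of Inl e' \<Rightarrow> emap f'' e' | Inr w \<Rightarrow> Inr (vmap f'' w)),
      vhom = (\<lambda>v g. vhom f'' (vmap f' v) (vhom f' v g)),
      ehom = (\<lambda>e h. case emap f' e of Inl e' \<Rightarrow> ehom f'' e' (ehom f' e h) | Inr w \<Rightarrow> undefined),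
      chom = (\<lambda>e h. case emap f' e of
                Inl e' \<Rightarrow> chom f'' e' (ehom f' e h) | Inr w \<Rightarrow> vhom f'' w (chom f' e h)),
      delta = (\<lambda>e. let x = vmap f' (head (gr \<L>) e); d = vhom f'' x (delta f' e) in
                case emap f' e of
                  Inl e' \<Rightarrow> d \<otimes>\<^bsub>vgrp \<N> (vmap f'' x)\<^esub> delta f'' e' | Inr w \<Rightarrow> d)\<rparr>"

text \<open>
  The morphism \<open>f'\<close> arises from \<open>f\<close> by moving the image of each vertex \<open>v\<close> around \<open>m v\<close>: vertex
  homomorphisms are conjugated and the elements \<open>\<delta>\<^sub>e\<close> corrected accordingly. For a collapsed edge,
  whose group also maps to a vertex group, a further conjugation by some \<open>k\<close>, common to both
  orientations, is allowed. So \<open>f'\<close> sends the path \<open>e\<close>, which \<open>f\<close> sends to \<open>\<delta>\<^sub>e\<^sub>' f(e) \<delta>\<^sub>e\<inverse>\<close> with \<open>e'\<close>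
  the reverse of \<open>e\<close>, to \<open>m(o(e)) \<delta>\<^sub>e\<^sub>' f(e) \<delta>\<^sub>e\<inverse> m(\<tau>(e))\<inverse>\<close>.
\<close>

definition conjugate_by ::
  "('v, 'e, 'g, 'h) gog \<Rightarrow> ('w, 'd, 'k, 'l) gog \<Rightarrow> ('v \<Rightarrow> 'k) \<Rightarrow>
   ('v, 'e, 'g, 'h, 'w, 'd, 'k, 'l) gog_map \<Rightarrow> ('v, 'e, 'g, 'h, 'w, 'd, 'k, 'l) gog_map \<Rightarrow> bool"
  where
  "conjugate_by \<L> \<G> m f f' \<longleftrightarrow>
     (\<forall>v\<in>verts (gr \<L>).
        let V = vgrp \<G> (vmap f v) in
        vmap f' v = vmap f v \<and> m v \<in> carrier V \<and>
        (\<forall>g\<in>carrier (vgrp \<L> v). vhom f' v g = m v \<otimes>\<^bsub>V\<^esub> vhom f v g \<otimes>\<^bsub>V\<^esub> inv\<^bsub>V\<^esub> (m v))) \<and>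
     (\<forall>e\<in>arcs (gr \<L>).
        let x = head (gr \<L>) e; V = vgrp \<G> (vmap f x) in
        emap f' e = emap f e \<and>
        (case emap f e of
           Inl e' \<Rightarrow>
             (\<forall>h\<in>carrier (egrp \<L> e). ehom f' e h = ehom f e h) \<and>
             delta f' e = m x \<otimes>\<^bsub>V\<^esub> delta f e
         | Inr w \<Rightarrow>
             \<exists>k\<in>carrier V.
               (\<forall>h\<in>carrier (egrp \<L> e). chom f' e h = k \<otimes>\<^bsub>V\<^esub> chom f e h \<otimes>\<^bsub>V\<^esub> inv\<^bsub>V\<^esub> k) \<and>
               delta f' e = m x \<otimes>\<^bsub>V\<^esub> delta f e \<otimes>\<^bsub>V\<^esub> inv\<^bsub>V\<^esub> k \<and>
               delta f' (arev \<L> e) =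
                 m (tail (gr \<L>) e) \<otimes>\<^bsub>V\<^esub> delta f (arev \<L> e) \<otimes>\<^bsub>V\<^esub> inv\<^bsub>V\<^esub> k))"

text \<open>Equality of morphisms, ignoring values outside the source.\<close>

definition same_morphism ::
  "('v, 'e, 'g, 'h) gog \<Rightarrow>
   ('v, 'e, 'g, 'h, 'w, 'd, 'k, 'l) gog_map \<Rightarrow> ('v, 'e, 'g, 'h, 'w, 'd, 'k, 'l) gog_map \<Rightarrow> bool"
  where
  "same_morphism \<L> f f' \<longleftrightarrow>
     (\<forall>v\<in>verts (gr \<L>).
        vmap f' v = vmap f v \<and> (\<forall>g\<in>carrier (vgrp \<L> v). vhom f' v g = vhom f v g)) \<and>
     (\<forall>e\<in>arcs (gr \<L>).
        emap f' e = emap f e \<and> delta f' e = delta f e \<and>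
        (\<forall>h\<in>carrier (egrp \<L> e).
           if isl (emap f e) then ehom f' e h = ehom f e h else chom f' e h = chom f e h))"


section \<open>Collapsing a subgraph\<close>

text \<open>
  All components of a subgraph \<open>H\<close> are collapsed at once, which is the direct limit of the collapses
  of single components. The subgraph \<open>H\<close> must be spanning and closed under reversal. Requiring it
  to be spanning loses nothing: a component without edges is a vertex \<open>v\<close>, and collapsing it
  only replaces its group by the group \<open>\<pi>\<^sub>1\<close> of constant paths at \<open>v\<close>. The vertices of the collapsed
  graph are the vertex sets of the components; strong components of graphs with
  reversal are connected components.

  The identification of the new vertex groups with \<open>\<pi>\<^sub>1\<close> and the inclusions of the old ones need
  choices: a base point \<open>base C\<close> in each component, and a path \<open>link v\<close> to \<open>v\<close> from the base point
  of its component. Moreover the collapse morphism has, for a collapsed edge \<open>e\<close>, an element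
  \<open>shift e\<close> as \<open>\<delta>\<^sub>e\<close>. As a morphism sends the path \<open>e\<close> to \<open>\<delta>\<^sub>e\<^sub>' \<delta>\<^sub>e\<inverse>\<close> (where \<open>e'\<close> is the reverse of
  \<open>e\<close>), this product must be the class of \<open>link(o(e)) e link(\<tau>(e))\<inverse>\<close>.
\<close>

record ('v, 'e, 'g) collapse_choice =
  base :: "'v set \<Rightarrow> 'v"
  link :: "'v \<Rightarrow> ('g, 'e) gpath"
  shift :: "'e \<Rightarrow> ('g, 'e) gpath set"

definition component_gog ::
  "('v, 'e, 'g, 'h) gog \<Rightarrow> ('v, 'e) pre_digraph \<Rightarrow> 'v set \<Rightarrow> ('v, 'e, 'g, 'h) gog" where
  "component_gog \<L> H C = restrict_gog \<L> (H \<restriction> C)"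

text \<open>The class of \<open>link(u) p link(v)\<inverse>\<close> for a path \<open>p\<close> from \<open>u\<close> to \<open>v\<close> in a component of \<open>H\<close>.\<close>

definition linked_class ::
  "('v, 'e, 'g, 'h) gog \<Rightarrow> ('v, 'e) pre_digraph \<Rightarrow> ('v, 'e, 'g) collapse_choice \<Rightarrow>
   'v \<Rightarrow> ('g, 'e) gpath \<Rightarrow> 'v \<Rightarrow> ('g, 'e) gpath set" where
  "linked_class \<L> H \<chi> u p v =
     (let C = pre_digraph.scc_of H u; K = component_gog \<L> H C; b = base \<chi> C in
      loop_class K b
        (path_cat K b (link \<chi> u) (path_cat K u p (path_rev K b (link \<chi> v)))))"

definition is_collapse_choice ::
  "('v, 'e, 'g, 'h) gog \<Rightarrow> ('v, 'e) pre_digraph \<Rightarrow> ('v, 'e, 'g) collapse_choice \<Rightarrow> bool" where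
  "is_collapse_choice \<L> H \<chi> \<longleftrightarrow>
     (\<forall>C\<in>pre_digraph.sccs_verts H.
        base \<chi> C \<in> C \<and>
        (\<forall>v\<in>C. is_path (component_gog \<L> H C) (base \<chi> C) (link \<chi> v) v)) \<and>
     (\<forall>e\<in>arcs H.
        let u = tail H e; v = head H e; C = pre_digraph.scc_of H v;
            P = pi1 (component_gog \<L> H C) (base \<chi> C) in
        shift \<chi> e \<in> carrier P \<and>
        shift \<chi> (arev \<L> e) \<otimes>\<^bsub>P\<^esub> inv\<^bsub>P\<^esub> (shift \<chi> e) =
          linked_class \<L> H \<chi> u (\<one>\<^bsub>vgrp \<L> u\<^esub>, [(e, \<one>\<^bsub>vgrp \<L> v\<^esub>)]) v)"

definition collapse ::
  "('v, 'e, 'g, 'h) gog \<Rightarrow> ('v, 'e) pre_digraph \<Rightarrow> ('v, 'e, 'g) collapse_choice \<Rightarrow>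
   ('v set, 'e, ('g, 'e) gpath set, 'h) gog" where
  "collapse \<L> H \<chi> =
     \<lparr>gr = \<lparr>verts = pre_digraph.sccs_verts H,
            arcs = arcs (gr \<L>) - arcs H,
            tail = (\<lambda>e. pre_digraph.scc_of H (tail (gr \<L>) e)),
            head = (\<lambda>e. pre_digraph.scc_of H (head (gr \<L>) e))\<rparr>,
      arev = perm_restrict (arev \<L>) (arcs (gr \<L>) - arcs H),
      vgrp = (\<lambda>C. pi1 (component_gog \<L> H C) (base \<chi> C)),
      egrp = egrp \<L>,
      inc = (\<lambda>e h. let v = head (gr \<L>) e in linked_class \<L> H \<chi> v (inc \<L> e h, []) v)\<rparr>"

text \<open>On a collapsed edge the homomorphism is determined by \<open>\<delta>\<^sub>e\<close> and the vertex homomorphisms.\<close>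

definition collapse_map ::
  "('v, 'e, 'g, 'h) gog \<Rightarrow> ('v, 'e) pre_digraph \<Rightarrow> ('v, 'e, 'g) collapse_choice \<Rightarrow>
   ('v, 'e, 'g, 'h, 'v set, 'e, ('g, 'e) gpath set, 'h) gog_map" where
  "collapse_map \<L> H \<chi> =
     \<lparr>vmap = pre_digraph.scc_of H,
      emap = (\<lambda>e. if e \<in> arcs H then Inr (pre_digraph.scc_of H (head H e)) else Inl e),
      vhom = (\<lambda>v g. linked_class \<L> H \<chi> v (g, []) v),
      ehom = (\<lambda>e h. h),
      chom = (\<lambda>e h. let v = head H e; P = vgrp (collapse \<L> H \<chi>) (pre_digraph.scc_of H v) in
                inv\<^bsub>P\<^esub> (shift \<chi> e) \<otimes>\<^bsub>P\<^esub> linked_class \<L> H \<chi> v (inc \<L> e h, []) v \<otimes>\<^bsub>P\<^esub> shift \<chi> e),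
      delta = (\<lambda>e. if e \<in> arcs H then shift \<chi> e
                else \<one>\<^bsub>vgrp (collapse \<L> H \<chi>) (pre_digraph.scc_of H (head (gr \<L>) e))\<^esub>)\<rparr>"


section \<open>Collapsing a morphism onto its image\<close>

definition image_gog ::
  "('v, 'e, 'g, 'h) gog \<Rightarrow> ('w, 'd, 'k, 'l) gog \<Rightarrow>
   ('v, 'e, 'g, 'h, 'w, 'd, 'k, 'l) gog_map \<Rightarrow> ('v, 'e, 'k, 'l) gog" where
  "image_gog \<L> \<G> f =
     \<lparr>gr = gr \<L>,
      arev = arev \<L>,
      vgrp = (\<lambda>v. (vgrp \<G> (vmap f v))\<lparr>carrier := vhom f v ` carrier (vgrp \<L> v)\<rparr>),
      egrp = (\<lambda>e. (egrp \<G> (projl (emap f e)))\<lparr>carrier := ehom f e ` carrier (egrp \<L> e)\<rparr>),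
      inc = (\<lambda>e h. let V = vgrp \<G> (vmap f (head (gr \<L>) e)) in
               delta f e \<otimes>\<^bsub>V\<^esub> inc \<G> (projl (emap f e)) h \<otimes>\<^bsub>V\<^esub> inv\<^bsub>V\<^esub> (delta f e))\<rparr>"

definition onto_image ::
  "('v, 'e, 'g, 'h) gog \<Rightarrow> ('w, 'd, 'k, 'l) gog \<Rightarrow>
   ('v, 'e, 'g, 'h, 'w, 'd, 'k, 'l) gog_map \<Rightarrow> ('v, 'e, 'g, 'h, 'v, 'e, 'k, 'l) gog_map" where
  "onto_image \<L> \<G> f =
     \<lparr>vmap = (\<lambda>v. v), emap = Inl, vhom = vhom f, ehom = ehom f, chom = undefined,
      delta = (\<lambda>e. \<one>\<^bsub>vgrp \<G> (vmap f (head (gr \<L>) e))\<^esub>)\<rparr>"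

definition image_inclusion ::
  "('v, 'e, 'g, 'h, 'w, 'd, 'k, 'l) gog_map \<Rightarrow> ('v, 'e, 'k, 'l, 'w, 'd, 'k, 'l) gog_map" where
  "image_inclusion f =
     \<lparr>vmap = vmap f, emap = emap f, vhom = (\<lambda>v g. g), ehom = (\<lambda>e h. h), chom = undefined,
      delta = delta f\<rparr>"


section \<open>Collapsing the fibres of a morphism\<close>

definition fibre ::
  "('v, 'e, 'g, 'h) gog \<Rightarrow> ('v, 'e, 'g, 'h, 'w, 'd, 'k, 'l) gog_map \<Rightarrow> 'w \<Rightarrow>
   ('v, 'e) pre_digraph" where
  "fibre \<L> f w =
     \<lparr>verts = {v \<in> verts (gr \<L>). vmap f v = w}, arcs = {e \<in> arcs (gr \<L>). emap f e = Inr w},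
      tail = tail (gr \<L>), head = head (gr \<L>)\<rparr>"

text \<open>
  The fibres are disjoint and without edges between them, so that the components of the union
  are the components of the fibres.
\<close>

definition fibres ::
  "('v, 'e, 'g, 'h) gog \<Rightarrow> ('w, 'd, 'k, 'l) gog \<Rightarrow>
   ('v, 'e, 'g, 'h, 'w, 'd, 'k, 'l) gog_map \<Rightarrow> ('v, 'e) pre_digraph" where
  "fibres \<L> \<G> f = pre_digraph.Union (gr \<L>) (fibre \<L> f ` verts (gr \<G>))"

text \<open>
  The image under \<open>f\<close>, an element of a vertex group of \<open>\<G>\<close>, of a path starting at \<open>u\<close> all of whose
  edges are collapsed by \<open>f\<close>; such an edge \<open>e\<close> is sent to \<open>\<delta>\<^sub>e\<^sub>' \<delta>\<^sub>e\<inverse>\<close>, where \<open>e'\<close> is its reverse.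
\<close>

fun fibre_value ::
  "('v, 'e, 'g, 'h) gog \<Rightarrow> ('w, 'd, 'k, 'l) gog \<Rightarrow>
   ('v, 'e, 'g, 'h, 'w, 'd, 'k, 'l) gog_map \<Rightarrow> 'v \<Rightarrow> ('g, 'e) gpath \<Rightarrow> 'k" where
  "fibre_value \<L> \<G> f u (g, []) = vhom f u g"
| "fibre_value \<L> \<G> f u (g, (e, k) # s) =
     (let V = vgrp \<G> (vmap f u) in
      vhom f u g \<otimes>\<^bsub>V\<^esub> delta f (arev \<L> e) \<otimes>\<^bsub>V\<^esub> inv\<^bsub>V\<^esub> (delta f e) \<otimes>\<^bsub>V\<^esub>
        fibre_value \<L> \<G> f (head (gr \<L>) e) (k, s))"

text \<open>
  The morphism that \<open>f\<close> induces on the collapse of its fibres: on vertex groups it is the map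
  induced by \<open>f\<close> on \<open>\<pi>\<^sub>1\<close>, and the remaining edges are mapped as by \<open>f\<close>. The new inclusion at \<open>e\<close>
  being conjugated by \<open>link(\<tau>(e))\<close>, the new \<open>\<delta>\<^sub>e\<close> is the image of that path times the old one.
\<close>

definition fibre_descent ::
  "('v, 'e, 'g, 'h) gog \<Rightarrow> ('w, 'd, 'k, 'l) gog \<Rightarrow>
   ('v, 'e, 'g, 'h, 'w, 'd, 'k, 'l) gog_map \<Rightarrow> ('v, 'e, 'g) collapse_choice \<Rightarrow>
   ('v set, 'e, ('g, 'e) gpath set, 'h, 'w, 'd, 'k, 'l) gog_map" where
  "fibre_descent \<L> \<G> f \<chi> =
     \<lparr>vmap = (\<lambda>C. vmap f (base \<chi> C)),
      emap = emap f,
      vhom = (\<lambda>C X. the_elem (fibre_value \<L> \<G> f (base \<chi> C) ` X)),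
      ehom = ehom f,
      chom = undefined,
      delta = (\<lambda>e. let v = head (gr \<L>) e in
                fibre_value \<L> \<G> f (base \<chi> (pre_digraph.scc_of (fibres \<L> \<G> f) v)) (link \<chi> v)
                  \<otimes>\<^bsub>vgrp \<G> (vmap f v)\<^esub> delta f e)\<rparr>"

end

theory Submission
  imports Defs
begin

text \<open>
  The only deep point is that collapsing a subgraph keeps the edge inclusions injective, that is, that
  vertex groups embed in the fundamental group. Rather than through normal forms, this is seen by
  letting the fundamental groupoid act: a homomorphism from each vertex group to a group \<open>A\<close> together
  with compatible values for the edges assigns to each path an element of \<open>A\<close> that depends only on its
  homotopy class, and for a suitable permutation group \<open>A\<close> the homomorphisms can be chosen injective.
  With \<open>A\<close> a vertex group of the target, the same principle shows that a morphism
  induces homomorphisms on the fundamental groups of the components of its fibres.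
\<close>

section \<open>Paths and the fundamental group\<close>

text \<open>The factorization is one up to conjugation. An element g of a vertex group becomes a
  loop at the base point of its component only after \<open>link v\<close> and its reverse are
  attached, so the composite through the collapse sends g to its image under f conjugated by the
  value of \<open>link v\<close>. These values are the elements \<open>m v\<close> of the statement.
  For a collapsed edge, paths see only the product of the element at the reversed edge with the
  inverse of the element at the edge. A common right factor of the two stays free, whence the
  \<open>k\<close> in \<open>conjugate_by\<close>. The collapse onto the image adds no further
  conjugation. The obstacle to representing the groupoid is that an edge group acts through both of
  its ends and may have quite different indices in the two vertex groups. Letting every vertex group
  act on one infinite set, at least as large as each of them and consisting of as many free orbits
  as it has points, makes the index invisible.\<close>

context graph_of_groups
begin

section \<open>Concatenation and reversal of paths\<close>

lemma path_cat_Cons: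
  "path_cat \<G> u (g, (e, k) # s) q =
    (g, (e, fst (path_cat \<G> (head (gr \<G>) e) (k, s) q)) #
      snd (path_cat \<G> (head (gr \<G>) e) (k, s) q))"
  by (simp add: case_prod_beta)

lemma is_path_verts:
  assumes "is_path \<G> u p v"
  shows "u \<in> verts (gr \<G>)" "v \<in> verts (gr \<G>)"
proof -
  have "u \<in> verts (gr \<G>) \<and> v \<in> verts (gr \<G>)" if "is_path \<G> u (g, s) v" for g s
    using that by (induction s arbitrary: u g) auto
  then show "u \<in> verts (gr \<G>)" "v \<in> verts (gr \<G>)"
    using assms by (cases p; blast)+
qed

lemma is_path_fst: "is_path \<G> u p v \<Longrightarrow> fst p \<in> carrier (vgrp \<G> u)"
  by (cases "(\<G>, u, p, v)" rule: is_path.cases) auto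

lemma is_path_one: "u \<in> verts (gr \<G>) \<Longrightarrow> is_path \<G> u (\<one>\<^bsub>vgrp \<G> u\<^esub>, []) u"
  by (simp add: group.is_monoid monoid.one_closed vgrp_group)

lemma is_path_mult:
  assumes "is_path \<G> u (g', t) w" "g \<in> carrier (vgrp \<G> u)"
  shows "is_path \<G> u (g \<otimes>\<^bsub>vgrp \<G> u\<^esub> g', t) w"
proof -
  show ?thesis using assms by (cases t) (auto simp: group.is_monoid monoid.m_closed vgrp_group)
qed

lemma is_path_cat:
  assumes "is_path \<G> u p v" "is_path \<G> v q w"
  shows "is_path \<G> u (path_cat \<G> u p q) w"
proof -
  have "is_path \<G> u (path_cat \<G> u (g, s) q) w" if "is_path \<G> u (g, s) v" for g s
    using that
  proof (induction s arbitrary: u g)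
    case Nil
    then show ?case using assms(2) by (cases q) (auto intro: is_path_mult)
  next
    case (Cons x s)
    obtain e k where [simp]: "x = (e, k)" by (cases x)
    from Cons show ?case by (simp add: path_cat_Cons del: path_cat.simps)
  qed
  then show ?thesis using assms(1) by (cases p) blast
qed

lemma path_cat_assoc:
  assumes p: "is_path \<G> u p v" and q: "is_path \<G> v q w" and r: "is_path \<G> w r x"
  shows "path_cat \<G> u (path_cat \<G> u p q) r = path_cat \<G> u p (path_cat \<G> v q r)"
proof -
  have "path_cat \<G> u (path_cat \<G> u (g, s) q) r = path_cat \<G> u (g, s) (path_cat \<G> v q r)"
    if "is_path \<G> u (g, s) v" for g s
    using that
  proof (induction s arbitrary: u g)
    case Nil
    then have [simp]: "u = v" and g: "g \<in> carrier (vgrp \<G> v)" and v: "v \<in> verts (gr \<G>)" by auto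
    obtain g' t where [simp]: "q = (g', t)" by (cases q)
    obtain g'' t' where [simp]: "r = (g'', t')" by (cases r)
    show ?case
    proof (cases t)
      case Nil
      with q r g is_path_fst[OF r] show ?thesis 
        by (auto simp: group.is_monoid monoid.m_assoc vgrp_group)
    next
      case (Cons y t2)
      obtain e k where [simp]: "y = (e, k)" by (cases y)
      show ?thesis using Cons by (simp add: path_cat_Cons del: path_cat.simps(2))
    qed
  next
    case (Cons y s)
    obtain e k where [simp]: "y = (e, k)" by (cases y)
    from Cons show ?case by (simp add: path_cat_Cons del: path_cat.simps)
  qed
  then show ?thesis using p by (cases p) blast
qed

lemma path_cat_one_left:
  assumes "is_path \<G> u p v"
  shows "path_cat \<G> u (\<one>\<^bsub>vgrp \<G> u\<^esub>, []) p = p"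
  using is_path_fst[OF assms] vgrp_group[OF is_path_verts(1)[OF assms]]
  by (cases p) (simp add: group.is_monoid monoid.l_one)

lemma path_cat_append:
  assumes "is_path \<G> u p v"
  shows "path_cat \<G> u p (\<one>\<^bsub>vgrp \<G> v\<^esub>, t) = (fst p, snd p @ t)"
proof -
  have "path_cat \<G> u (g, s) (\<one>\<^bsub>vgrp \<G> v\<^esub>, t) = (g, s @ t)" if "is_path \<G> u (g, s) v" for g s
    using that
  proof (induction s arbitrary: u g)
    case Nil
    then show ?case by (auto simp add: group.is_monoid monoid.r_one vgrp_group)
  next
    case (Cons y s)
    obtain e k where [simp]: "y = (e, k)" by (cases y)
    from Cons show ?case by (simp add: path_cat_Cons del: path_cat.simps)
  qed
  then show ?thesis using assms by (cases p) simp
qed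

lemma path_cat_one_right:
  assumes "is_path \<G> u p v"
  shows "path_cat \<G> u p (\<one>\<^bsub>vgrp \<G> v\<^esub>, []) = p"
  using path_cat_append[OF assms, of "[]"] by simp

text \<open>The two claims depend on each other and so share one induction: writing the reversal as
  a concatenation requires the reversed tail to be a path with the right ends, and that the whole
  reversal is a path follows from the concatenation.\<close>

lemma path_rev_is_path_and_Cons:
  assumes "is_path \<G> u (g, s) v"
  shows "is_path \<G> v (path_rev \<G> u (g, s)) u \<and>
    (\<forall>e k t. s = (e, k) # t \<longrightarrow> path_rev \<G> u (g, s) =
      path_cat \<G> v (path_rev \<G> (head (gr \<G>) e) (k, t))
        (\<one>\<^bsub>vgrp \<G> (head (gr \<G>) e)\<^esub>, [(arev \<G> e, inv\<^bsub>vgrp \<G> u\<^esub> g)]))"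
  using assms
proof (induction s arbitrary: u g)
  case Nil
  then show ?case by (auto simp: group.inv_closed vgrp_group)
next
  case (Cons y t)
  obtain e k where [simp]: "y = (e, k)" by (cases y)
  from Cons.prems have e: "e \<in> arcs (gr \<G>)" and [simp]: "u = tail (gr \<G>) e"
    and g: "g \<in> carrier (vgrp \<G> u)" and t: "is_path \<G> (head (gr \<G>) e) (k, t) v"
    by auto
  have r: "is_path \<G> v (path_rev \<G> (head (gr \<G>) e) (k, t)) (head (gr \<G>) e)"
    using Cons.IH[OF t] by blast
  have a: "is_path \<G> (head (gr \<G>) e)
    (\<one>\<^bsub>vgrp \<G> (head (gr \<G>) e)\<^esub>, [(arev \<G> e, inv\<^bsub>vgrp \<G> u\<^esub> g)]) u"
    using e g is_path_one[of "head (gr \<G>) e"] by (simp add: group.inv_closed vgrp_group)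
  have "path_rev \<G> u (g, y # t) = path_cat \<G> v (path_rev \<G> (head (gr \<G>) e) (k, t))
        (\<one>\<^bsub>vgrp \<G> (head (gr \<G>) e)\<^esub>, [(arev \<G> e, inv\<^bsub>vgrp \<G> u\<^esub> g)])"
    using path_cat_append[OF r] by (simp add: case_prod_beta)
  with is_path_cat[OF r a] show ?case by simp
qed

lemma is_path_rev: "is_path \<G> u p v \<Longrightarrow> is_path \<G> v (path_rev \<G> u p) u"
  using path_rev_is_path_and_Cons by (cases p) blast

lemma path_rev_Cons:
  "is_path \<G> u (g, (e, k) # t) v \<Longrightarrow> path_rev \<G> u (g, (e, k) # t) =
    path_cat \<G> v (path_rev \<G> (head (gr \<G>) e) (k, t))
      (\<one>\<^bsub>vgrp \<G> (head (gr \<G>) e)\<^esub>, [(arev \<G> e, inv\<^bsub>vgrp \<G> u\<^esub> g)])"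
  using path_rev_is_path_and_Cons by blast

section \<open>Homotopy: endpoints, congruence, inverses\<close>

lemma inc_closed:
  "e \<in> arcs (gr \<G>) \<Longrightarrow> h \<in> carrier (egrp \<G> e) \<Longrightarrow> inc \<G> e h \<in> carrier (vgrp \<G> (head (gr \<G>) e))"
  using inc_mon[of e] by (auto simp: mon_def hom_def)

lemma inc_arev_closed:
  "e \<in> arcs (gr \<G>) \<Longrightarrow> h \<in> carrier (egrp \<G> e) \<Longrightarrow>
    inc \<G> (arev \<G> e) h \<in> carrier (vgrp \<G> (tail (gr \<G>) e))"
  using inc_closed[of "arev \<G> e" h] by (simp add: egrp_arev)

lemma vgrp_one_closed: "v \<in> verts (gr \<G>) \<Longrightarrow> \<one>\<^bsub>vgrp \<G> v\<^esub> \<in> carrier (vgrp \<G> v)"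
  using is_path_one by simp

lemma is_path_slide:
  assumes "e \<in> arcs (gr \<G>)" "h \<in> carrier (egrp \<G> e)"
  shows "is_path \<G> (tail (gr \<G>) e) (\<one>\<^bsub>vgrp \<G> (tail (gr \<G>) e)\<^esub>, [(e, inc \<G> e h)]) (head (gr \<G>) e)"
    "is_path \<G> (tail (gr \<G>) e)
      (inc \<G> (arev \<G> e) h, [(e, \<one>\<^bsub>vgrp \<G> (head (gr \<G>) e)\<^esub>)]) (head (gr \<G>) e)"
  using assms by (simp_all add: inc_closed inc_arev_closed vgrp_one_closed)

lemma homotopic_is_path:
  assumes "homotopic \<G> u v p q"
  shows "is_path \<G> u p v" "is_path \<G> u q v"
proof -
  have "is_path \<G> u p v \<and> is_path \<G> u q v"
    using assms
  proof induction
    case (slide e w x h u \<alpha> \<beta> v)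
    then show ?case using is_path_slide[of e h] by (metis is_path_cat)
  qed (auto intro: is_path_cat is_path_rev)
  then show "is_path \<G> u p v" "is_path \<G> u q v" by auto
qed

lemma path_cat_cat:
  assumes a: "is_path \<G> w a u" and p: "is_path \<G> u p z" and q: "is_path \<G> z q v"
    and b: "is_path \<G> v b x"
  shows "path_cat \<G> w a (path_cat \<G> u (path_cat \<G> u p q) b) =
    path_cat \<G> w (path_cat \<G> w a p) (path_cat \<G> z q b)"
  using path_cat_assoc[OF p q b] path_cat_assoc[OF a p is_path_cat[OF q b]] by simp

text \<open>The elementary moves carry an arbitrary prefix \<alpha> and suffix \<beta>. Putting
  \<open>a\<close> in front and \<open>b\<close> behind turns a move into the same move with
  \<open>a\<close> absorbed into the prefix and \<open>b\<close> into the suffix, so only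
  associativity is at stake.\<close>

lemma homotopic_cat_cong:
  assumes "homotopic \<G> u v p q" and "is_path \<G> w a u" and "is_path \<G> v b x"
  shows "homotopic \<G> w x (path_cat \<G> w a (path_cat \<G> u p b)) (path_cat \<G> w a (path_cat \<G> u q b))"
  using assms
proof (induction arbitrary: w a x b)
  case (refl u p v)
  then show ?case by (blast intro: homotopic.refl is_path_cat)
next
  case (sym u v p q)
  then show ?case by (blast intro: homotopic.sym)
next
  case (trans u v p q r)
  then show ?case by (blast intro: homotopic.trans)
next
  case (backtrack u \<alpha> z \<sigma> y \<beta> v)
  note \<sigma>r = is_path_rev[OF backtrack.hyps(2)]
  note r\<beta> = is_path_cat[OF \<sigma>r backtrack.hyps(3)]
  have "path_cat \<G> z (path_cat \<G> z \<sigma> (path_cat \<G> y (path_rev \<G> z \<sigma>) \<beta>)) b =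
      path_cat \<G> z \<sigma> (path_cat \<G> y (path_rev \<G> z \<sigma>) (path_cat \<G> z \<beta> b))"
    using path_cat_assoc[OF backtrack.hyps(2) r\<beta> backtrack.prems(2)]
      path_cat_assoc[OF \<sigma>r backtrack.hyps(3) backtrack.prems(2)] by simp
  with backtrack show ?case
    using homotopic.backtrack[OF is_path_cat[OF backtrack.prems(1) backtrack.hyps(1)]
        backtrack.hyps(2) is_path_cat[OF backtrack.hyps(3) backtrack.prems(2)]]
    by (simp add: path_cat_cat[OF backtrack.prems(1) backtrack.hyps(1) _ backtrack.prems(2)]
        is_path_cat[OF backtrack.hyps(2) r\<beta>] del: path_cat.simps)
next
  case (slide e z y h u \<alpha> \<beta> v)
  have s: "is_path \<G> z (\<one>\<^bsub>vgrp \<G> z\<^esub>, [(e, inc \<G> e h)]) y"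
      "is_path \<G> z (inc \<G> (arev \<G> e) h, [(e, \<one>\<^bsub>vgrp \<G> y\<^esub>)]) y"
    using is_path_slide slide.hyps by auto
  have eq: "path_cat \<G> w a (path_cat \<G> u (path_cat \<G> u \<alpha> (path_cat \<G> z \<sigma> \<beta>)) b) =
      path_cat \<G> w (path_cat \<G> w a \<alpha>) (path_cat \<G> z \<sigma> (path_cat \<G> y \<beta> b))"
    if "is_path \<G> z \<sigma> y" for \<sigma>
    using path_cat_cat[OF slide.prems(1) slide.hyps(5) is_path_cat[OF that slide.hyps(6)] slide.prems(2)]
      path_cat_assoc[OF that slide.hyps(6) slide.prems(2)] by simp
  show ?case
    unfolding eq[OF s(1)] eq[OF s(2)]
    by (rule homotopic.slide[OF slide.hyps(1-4) is_path_cat[OF slide.prems(1) slide.hyps(5)]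
        is_path_cat[OF slide.hyps(6) slide.prems(2)]])
qed

lemma homotopic_cat:
  assumes "homotopic \<G> u v p p'" "homotopic \<G> v w q q'"
  shows "homotopic \<G> u w (path_cat \<G> u p q) (path_cat \<G> u p' q')"
proof -
  note P = homotopic_is_path[OF assms(1)] and Q = homotopic_is_path[OF assms(2)]
  note u = is_path_one[OF is_path_verts(1)[OF P(1)]] and w = is_path_one[OF is_path_verts(2)[OF Q(1)]]
  have "homotopic \<G> u w (path_cat \<G> u p q) (path_cat \<G> u p' q)"
    using homotopic_cat_cong[OF assms(1) u Q(1)] path_cat_one_left is_path_cat P Q by metis
  moreover have "homotopic \<G> u w (path_cat \<G> u p' q) (path_cat \<G> u p' q')"
    using homotopic_cat_cong[OF assms(2) P(2) w] path_cat_one_right Q by metis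
  ultimately show ?thesis by (rule homotopic.trans)
qed

lemma homotopic_cat_rev:
  assumes p: "is_path \<G> u p v"
  shows "homotopic \<G> u u (path_cat \<G> u p (path_rev \<G> u p)) (\<one>\<^bsub>vgrp \<G> u\<^esub>, [])"
proof -
  note u = is_path_one[OF is_path_verts(1)[OF p]]
  note r = is_path_rev[OF p]
  show ?thesis
    using homotopic.sym[OF homotopic.backtrack[OF u p u]] path_cat_one_right[OF r]
      path_cat_one_left[OF is_path_cat[OF p r]] path_cat_one_left[OF u]
    by simp
qed

text \<open>The rule \<open>backtrack\<close> cancels a path followed by its reversal, not the other
  order. With q the reversal of p and r that of q, the path p q r is homotopic to both p and r;
  hence q p is homotopic to q r, which cancels. This is the argument that right inverses are left
  inverses, and it spares a proof that reversal is an involution.\<close>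

lemma homotopic_rev_cat:
  assumes p: "is_path \<G> u p v"
  shows "homotopic \<G> v v (path_cat \<G> v (path_rev \<G> u p) p) (\<one>\<^bsub>vgrp \<G> v\<^esub>, [])"
proof -
  define q where "q = path_rev \<G> u p"
  define r where "r = path_rev \<G> v q"
  have q: "is_path \<G> v q u" and r: "is_path \<G> u r v"
    using p is_path_rev by (auto simp: q_def r_def)
  note pq = homotopic_cat_rev[OF p, folded q_def] and qr = homotopic_cat_rev[OF q, folded r_def]
  have "homotopic \<G> u v (path_cat \<G> u p (path_cat \<G> v q r)) p"
    using homotopic_cat[OF homotopic.refl[OF p] qr] path_cat_one_right[OF p] by simp
  moreover have "homotopic \<G> u v (path_cat \<G> u p (path_cat \<G> v q r)) r"
    using homotopic_cat[OF pq homotopic.refl[OF r]] path_cat_one_left[OF r]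
      path_cat_assoc[OF p q r] by simp
  ultimately have "homotopic \<G> u v p r" by (blast intro: homotopic.sym homotopic.trans)
  from homotopic_cat[OF homotopic.refl[OF q] this] qr show ?thesis
    unfolding q_def[symmetric] by (blast intro: homotopic.trans)
qed

section \<open>The fundamental group\<close>

lemma loop_class_eq_iff:
  assumes "is_path \<G> b p b"
  shows "loop_class \<G> b p = loop_class \<G> b q \<longleftrightarrow> homotopic \<G> b b p q"
  using homotopic.refl[OF assms] unfolding loop_class_def
  by (blast intro: homotopic.sym homotopic.trans)

text \<open>The product in \<open>pi1\<close> is a union over all pairs of representatives. By
  congruence each pair contributes the same class, and the union is not over an empty family because
  p and q represent themselves.\<close>

lemma pi1_mult:
  assumes "is_path \<G> b p b" "is_path \<G> b q b"
  shows "loop_class \<G> b p \<otimes>\<^bsub>pi1 \<G> b\<^esub> loop_class \<G> b q = loop_class \<G> b (path_cat \<G> b p q)"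
proof -
  have *: "loop_class \<G> b (path_cat \<G> b p' q') = loop_class \<G> b (path_cat \<G> b p q)"
    if "p' \<in> loop_class \<G> b p" "q' \<in> loop_class \<G> b q" for p' q'
  proof -
    have "homotopic \<G> b b (path_cat \<G> b p q) (path_cat \<G> b p' q')"
      using that by (auto simp: loop_class_def intro: homotopic_cat)
    then show ?thesis by (rule loop_class_eq_iff[OF is_path_cat[OF assms], THEN iffD2, symmetric])
  qed
  have "p \<in> loop_class \<G> b p" "q \<in> loop_class \<G> b q"
    using assms by (auto simp: loop_class_def intro: homotopic.refl)
  then show ?thesis
    unfolding pi1_def monoid.select_convs by (intro SUP_eq_const *) auto
qed

lemma pi1_carrier: "carrier (pi1 \<G> b) = loop_class \<G> b ` {p. is_path \<G> b p b}"
  by (simp add: pi1_def)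

lemma pi1_one: "\<one>\<^bsub>pi1 \<G> b\<^esub> = loop_class \<G> b (\<one>\<^bsub>vgrp \<G> b\<^esub>, [])"
  by (simp add: pi1_def)

lemma group_pi1:
  assumes b: "b \<in> verts (gr \<G>)"
  shows "group (pi1 \<G> b)"
proof (rule groupI)
  note one = is_path_one[OF b]
  show "\<one>\<^bsub>pi1 \<G> b\<^esub> \<in> carrier (pi1 \<G> b)" using one by (auto simp: pi1_carrier pi1_one)
  show "X \<otimes>\<^bsub>pi1 \<G> b\<^esub> Y \<in> carrier (pi1 \<G> b)"
    if "X \<in> carrier (pi1 \<G> b)" "Y \<in> carrier (pi1 \<G> b)" for X Y
    using that by (auto simp: pi1_carrier pi1_mult intro: is_path_cat)
  show "X \<otimes>\<^bsub>pi1 \<G> b\<^esub> Y \<otimes>\<^bsub>pi1 \<G> b\<^esub> Z = X \<otimes>\<^bsub>pi1 \<G> b\<^esub> (Y \<otimes>\<^bsub>pi1 \<G> b\<^esub> Z)"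
    if "X \<in> carrier (pi1 \<G> b)" "Y \<in> carrier (pi1 \<G> b)" "Z \<in> carrier (pi1 \<G> b)" for X Y Z
    using that by (auto simp: pi1_carrier pi1_mult is_path_cat path_cat_assoc)
  show "\<one>\<^bsub>pi1 \<G> b\<^esub> \<otimes>\<^bsub>pi1 \<G> b\<^esub> X = X" if "X \<in> carrier (pi1 \<G> b)" for X
    using that one
    by (auto simp: pi1_carrier pi1_one pi1_mult path_cat_one_left simp del: path_cat.simps)
  show "\<exists>Y\<in>carrier (pi1 \<G> b). Y \<otimes>\<^bsub>pi1 \<G> b\<^esub> X = \<one>\<^bsub>pi1 \<G> b\<^esub>" if "X \<in> carrier (pi1 \<G> b)" for X
  proof -
    from that obtain p where p: "is_path \<G> b p b" and X: "X = loop_class \<G> b p"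
      by (auto simp: pi1_carrier)
    note r = is_path_rev[OF p]
    have "loop_class \<G> b (path_rev \<G> b p) \<otimes>\<^bsub>pi1 \<G> b\<^esub> X = \<one>\<^bsub>pi1 \<G> b\<^esub>"
      using homotopic_rev_cat[OF p] X p r
      by (simp add: pi1_one pi1_mult loop_class_eq_iff is_path_cat)
    with r show ?thesis unfolding pi1_carrier by blast
  qed
qed

end

section \<open>Representations of the fundamental groupoid\<close>

text \<open>This is a homomorphism from the fundamental groupoid to the group \<open>A\<close>,
  given on generators. The axioms \<open>t_arev\<close> and \<open>t_inc\<close> are what the two
  elementary homotopies, backtracking and sliding, demand of such values.\<close>

locale gog_rep = graph_of_groups \<G> + A: group A
  for \<G> :: "('v, 'e, 'g, 'h) gog" and A :: "'a monoid" +
  fixes \<phi> :: "'v \<Rightarrow> 'g \<Rightarrow> 'a" and t :: "'e \<Rightarrow> 'a"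
  assumes \<phi>_hom: "v \<in> verts (gr \<G>) \<Longrightarrow> \<phi> v \<in> hom (vgrp \<G> v) A"
    and t_closed: "e \<in> arcs (gr \<G>) \<Longrightarrow> t e \<in> carrier A"
    and t_arev: "e \<in> arcs (gr \<G>) \<Longrightarrow> t (arev \<G> e) = inv\<^bsub>A\<^esub> (t e)"
    and t_inc: "e \<in> arcs (gr \<G>) \<Longrightarrow> h \<in> carrier (egrp \<G> e) \<Longrightarrow>
      t e \<otimes>\<^bsub>A\<^esub> \<phi> (head (gr \<G>) e) (inc \<G> e h) = \<phi> (tail (gr \<G>) e) (inc \<G> (arev \<G> e) h) \<otimes>\<^bsub>A\<^esub> t e"
begin

fun path_val :: "'v \<Rightarrow> ('g, 'e) gpath \<Rightarrow> 'a" where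
  "path_val u (g, []) = \<phi> u g"
| "path_val u (g, (e, k) # s) = \<phi> u g \<otimes>\<^bsub>A\<^esub> (t e \<otimes>\<^bsub>A\<^esub> path_val (head (gr \<G>) e) (k, s))"

lemma \<phi>_closed: "v \<in> verts (gr \<G>) \<Longrightarrow> g \<in> carrier (vgrp \<G> v) \<Longrightarrow> \<phi> v g \<in> carrier A"
  using \<phi>_hom by (rule hom_in_carrier)

lemma \<phi>_one: "v \<in> verts (gr \<G>) \<Longrightarrow> \<phi> v \<one>\<^bsub>vgrp \<G> v\<^esub> = \<one>\<^bsub>A\<^esub>"
  using \<phi>_hom vgrp_group A.is_group by (rule hom_one)

lemma \<phi>_inv:
  "v \<in> verts (gr \<G>) \<Longrightarrow> g \<in> carrier (vgrp \<G> v) \<Longrightarrow> \<phi> v (inv\<^bsub>vgrp \<G> v\<^esub> g) = inv\<^bsub>A\<^esub> (\<phi> v g)"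
  by (meson \<phi>_hom vgrp_group A.is_group group_hom.hom_inv group_hom.intro group_hom_axioms.intro)

lemma path_val_closed:
  assumes "is_path \<G> u p v"
  shows "path_val u p \<in> carrier A"
proof -
  have "path_val u (g, s) \<in> carrier A" if "is_path \<G> u (g, s) v" for g s
    using that by (induction s arbitrary: u g) (auto simp: \<phi>_closed t_closed)
  then show ?thesis using assms by (cases p) blast
qed

lemma path_val_mult:
  assumes "is_path \<G> u (g', s) v" "g \<in> carrier (vgrp \<G> u)"
  shows "path_val u (g \<otimes>\<^bsub>vgrp \<G> u\<^esub> g', s) = \<phi> u g \<otimes>\<^bsub>A\<^esub> path_val u (g', s)"
proof -
  note u = is_path_verts(1)[OF assms(1)] and g' = is_path_fst[OF assms(1)]
  have m: "\<phi> u (g \<otimes>\<^bsub>vgrp \<G> u\<^esub> g') = \<phi> u g \<otimes>\<^bsub>A\<^esub> \<phi> u g'"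
    using hom_mult[OF \<phi>_hom[OF u]] assms(2) g' by simp
  show ?thesis
  proof (cases s)
    case Nil
    then show ?thesis using m by simp
  next
    case (Cons x s')
    obtain e k where [simp]: "x = (e, k)" by (cases x)
    from assms(1) Cons have "e \<in> arcs (gr \<G>)" "is_path \<G> (head (gr \<G>) e) (k, s') v" by auto
    then show ?thesis
      using Cons u g' assms(2) m by (simp add: A.m_assoc \<phi>_closed t_closed path_val_closed)
  qed
qed

lemma path_val_cat:
  assumes "is_path \<G> u p v" "is_path \<G> v q w"
  shows "path_val u (path_cat \<G> u p q) = path_val u p \<otimes>\<^bsub>A\<^esub> path_val v q"
proof -
  have "path_val u (path_cat \<G> u (g, s) q) = path_val u (g, s) \<otimes>\<^bsub>A\<^esub> path_val v q"
    if "is_path \<G> u (g, s) v" for g s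
    using that
  proof (induction s arbitrary: u g)
    case Nil
    then show ?case using assms(2) path_val_mult by (cases q) auto
  next
    case (Cons x s)
    obtain e k where [simp]: "x = (e, k)" by (cases x)
    from Cons assms(2) show ?case
      by (auto simp: path_cat_Cons A.m_assoc \<phi>_closed t_closed path_val_closed simp del: path_cat.simps)
  qed
  then show ?thesis using assms(1) by (cases p) blast
qed

lemma path_val_rev:
  assumes "is_path \<G> u p v"
  shows "path_val v (path_rev \<G> u p) = inv\<^bsub>A\<^esub> (path_val u p)"
proof -
  have "path_val v (path_rev \<G> u (g, s)) = inv\<^bsub>A\<^esub> (path_val u (g, s))"
    if "is_path \<G> u (g, s) v" for g s
    using that
  proof (induction s arbitrary: u g)
    case Nil
    then show ?case by (auto simp: \<phi>_inv)
  next
    case (Cons x s)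
    obtain e k where [simp]: "x = (e, k)" by (cases x)
    from Cons.prems have e: "e \<in> arcs (gr \<G>)" and u: "u = tail (gr \<G>) e"
      and g: "g \<in> carrier (vgrp \<G> u)" and s: "is_path \<G> (head (gr \<G>) e) (k, s) v"
      by auto
    have uv: "u \<in> verts (gr \<G>)" using u e by simp
    have "is_path \<G> (head (gr \<G>) e)
        (\<one>\<^bsub>vgrp \<G> (head (gr \<G>) e)\<^esub>, [(arev \<G> e, inv\<^bsub>vgrp \<G> u\<^esub> g)]) u"
      using e g u vgrp_one_closed by (simp add: group.inv_closed vgrp_group)
    note cat = path_val_cat[OF is_path_rev[OF s] this]
    have eq: "path_rev \<G> u (g, x # s) = path_cat \<G> v (path_rev \<G> (head (gr \<G>) e) (k, s))
        (\<one>\<^bsub>vgrp \<G> (head (gr \<G>) e)\<^esub>, [(arev \<G> e, inv\<^bsub>vgrp \<G> u\<^esub> g)])"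
      using Cons.prems by (simp add: path_rev_Cons del: path_rev.simps)
    show ?case
      unfolding eq cat Cons.IH[OF s]
      using e g u uv path_val_closed[OF s]
      by (simp add: \<phi>_one \<phi>_inv t_arev t_closed \<phi>_closed A.inv_mult_group A.m_assoc)
  qed
  then show ?thesis using assms by (cases p) blast
qed

text \<open>Only the generating moves need attention. Backtracking is handled by multiplicativity
  and inversion of \<open>path_val\<close>; sliding alters just the middle factor, where the axiom
  \<open>t_inc\<close> applies.\<close>

lemma path_val_homotopic:
  assumes "homotopic \<G> u v p q"
  shows "path_val u p = path_val u q"
  using assms
proof induction
  case (backtrack u \<alpha> w \<sigma> x \<beta> v)
  note r = is_path_rev[OF backtrack.hyps(2)]
  note closed = backtrack.hyps[THEN path_val_closed]
  show ?case
    by (simp add: path_val_cat[OF backtrack.hyps(1,3)]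
        path_val_cat[OF backtrack.hyps(1) is_path_cat[OF backtrack.hyps(2) is_path_cat[OF r backtrack.hyps(3)]]]
        path_val_cat[OF backtrack.hyps(2) is_path_cat[OF r backtrack.hyps(3)]]
        path_val_cat[OF r backtrack.hyps(3)] path_val_rev[OF backtrack.hyps(2)] closed
        A.m_assoc[symmetric] del: path_cat.simps)
next
  case (slide e w x h u \<alpha> \<beta> v)
  have s: "is_path \<G> w (\<one>\<^bsub>vgrp \<G> w\<^esub>, [(e, inc \<G> e h)]) x"
      "is_path \<G> w (inc \<G> (arev \<G> e) h, [(e, \<one>\<^bsub>vgrp \<G> x\<^esub>)]) x"
    using is_path_slide slide.hyps by auto
  have "path_val w (\<one>\<^bsub>vgrp \<G> w\<^esub>, [(e, inc \<G> e h)]) =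
      path_val w (inc \<G> (arev \<G> e) h, [(e, \<one>\<^bsub>vgrp \<G> x\<^esub>)])"
    using slide.hyps by (simp add: \<phi>_one t_inc t_closed \<phi>_closed inc_closed inc_arev_closed)
  moreover have "path_val u (path_cat \<G> u \<alpha> (path_cat \<G> w \<sigma> \<beta>)) =
      path_val u \<alpha> \<otimes>\<^bsub>A\<^esub> (path_val w \<sigma> \<otimes>\<^bsub>A\<^esub> path_val x \<beta>)" if "is_path \<G> w \<sigma> x" for \<sigma>
    using path_val_cat[OF slide.hyps(5) is_path_cat[OF that slide.hyps(6)]]
      path_val_cat[OF that slide.hyps(6)] by simp
  note this[OF s(1)] this[OF s(2)]
  ultimately show ?case by simp
qed auto

text \<open>Homotopy invariance makes the image of a class a singleton. The form with
  \<open>the_elem\<close> is the one in which the vertex homomorphisms of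
  \<open>fibre_descent\<close> are defined.\<close>

lemma path_val_class:
  assumes "is_path \<G> b p b"
  shows "the_elem (path_val b ` loop_class \<G> b p) = path_val b p"
proof -
  have "path_val b ` loop_class \<G> b p = {path_val b p}"
    using path_val_homotopic homotopic.refl[OF assms] unfolding loop_class_def by fastforce
  then show ?thesis by simp
qed

lemma path_val_pi1_hom: "(\<lambda>X. the_elem (path_val b ` X)) \<in> hom (pi1 \<G> b) A"
  by (rule homI) (auto simp: pi1_carrier pi1_mult path_val_class path_val_closed is_path_cat
      path_val_cat simp del: path_cat.simps)

end

section \<open>Free actions on an infinite set\<close>

definition perm_group :: "('z \<Rightarrow> 'z) monoid" where
  "perm_group = \<lparr>carrier = {f. bij f}, monoid.mult = (\<circ>), one = id\<rparr>"

lemma group_perm_group: "group perm_group"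
proof (rule groupI)
  show "\<exists>y\<in>carrier perm_group. y \<otimes>\<^bsub>perm_group\<^esub> f = \<one>\<^bsub>perm_group\<^esub>"
    if "f \<in> carrier perm_group" for f :: "'z \<Rightarrow> 'z"
    using that bij_imp_bij_inv[of f] bij_is_inj[of f]
    by (intro bexI[of _ "inv_into UNIV f"]) (auto simp: perm_group_def)
qed (auto simp: perm_group_def bij_comp)

text \<open>Cardinal absorption: a nonempty factor no larger than the infinite set does not change
  its size. The injection \<iota> witnesses the bound.\<close>

lemma bij_betw_Times_infinite:
  fixes \<iota> :: "'a \<Rightarrow> 'z"
  assumes "infinite (UNIV :: 'z set)" "A \<noteq> {}" "inj_on \<iota> A"
  obtains f where "bij_betw f (A \<times> (UNIV :: 'z set)) (UNIV :: 'z set)"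
  using card_of_Times_infinite[OF assms(1,2)] card_of_ordLeq[of A "UNIV :: 'z set"]
    card_of_ordIso[of "A \<times> (UNIV :: 'z set)" "UNIV :: 'z set"] assms(3)
  by blast

text \<open>With S the image of E, choosing representatives identifies V with the product of S and
  the set of right cosets of S, compatibly with left multiplication by S. Absorbing the cosets into
  the infinite second factor leaves E times that factor, so the index of E in V disappears. This is
  what lets the two ends of an edge be compared.\<close>

lemma equivariant_bij:
  fixes V :: "'g monoid" and E :: "'h monoid"
  assumes "group V" "group E" and i: "i \<in> mon E V"
    and Z: "infinite (UNIV :: 'z set)" and \<iota>: "inj_on (\<iota> :: 'g \<Rightarrow> 'z) (carrier V)"
  obtains \<beta> :: "'g \<times> 'z \<Rightarrow> 'h \<times> 'z"
  where "bij_betw \<beta> (carrier V \<times> UNIV) (carrier E \<times> UNIV)"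
    and "\<And>h x z. h \<in> carrier E \<Longrightarrow> x \<in> carrier V \<Longrightarrow>
      \<beta> (i h \<otimes>\<^bsub>V\<^esub> x, z) = (h \<otimes>\<^bsub>E\<^esub> fst (\<beta> (x, z)), snd (\<beta> (x, z)))"
proof -
  interpret V: group V by fact
  interpret E: group E by fact
  interpret i: group_hom E V i
    using i by (auto simp: group_hom_def group_hom_axioms_def mon_def V.is_group E.is_group)
  have inj: "inj_on i (carrier E)" using i by (simp add: mon_def)
  define S where "S = i ` carrier E"
  interpret S: subgroup S V using i.img_is_subgroup by (simp add: S_def)
  define r where "r R = (SOME r. r \<in> R)" for R :: "'g set"
  have r: "r R \<in> R" "r R \<in> carrier V" "S #>\<^bsub>V\<^esub> r R = R" if "R \<in> rcosets\<^bsub>V\<^esub> S" for R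
  proof -
    have "R \<noteq> {}" using that S.rcosets_non_empty by blast
    then show *: "r R \<in> R" by (simp add: r_def some_in_eq)
    with that show "r R \<in> carrier V"
      using V.rcosets_part_G[OF S.subgroup_axioms] by blast
    show "S #>\<^bsub>V\<^esub> r R = R"
      using that * V.repr_independence S.subgroup_axioms by (auto simp: RCOSETS_def)
  qed
  \<comment> \<open>Representatives embed the set of cosets into V, and \<iota> embeds V into the
    infinite set; this is the size bound needed for absorption.\<close>
  have inj_r: "inj_on (\<lambda>R. \<iota> (r R)) (rcosets\<^bsub>V\<^esub> S)"
    using inj_onD[OF \<iota>] r(2,3) by (intro inj_onI) metis
  have ne: "rcosets\<^bsub>V\<^esub> S \<noteq> {}" by (auto simp: RCOSETS_def)
  obtain \<kappa> where \<kappa>: "bij_betw \<kappa> ((rcosets\<^bsub>V\<^esub> S) \<times> (UNIV :: 'z set)) (UNIV :: 'z set)"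
    by (rule bij_betw_Times_infinite[OF Z ne inj_r])
  have coset: "S #>\<^bsub>V\<^esub> x \<in> rcosets\<^bsub>V\<^esub> S" if "x \<in> carrier V" for x
    using that by (auto simp: RCOSETS_def)
  have div: "x \<otimes>\<^bsub>V\<^esub> inv\<^bsub>V\<^esub> r (S #>\<^bsub>V\<^esub> x) \<in> S" if x: "x \<in> carrier V" for x
  proof -
    have "x \<in> S #>\<^bsub>V\<^esub> r (S #>\<^bsub>V\<^esub> x)"
      using r(3)[OF coset[OF x]] V.rcos_self[OF x S.subgroup_axioms] by simp
    then obtain s where "s \<in> S" "x = s \<otimes>\<^bsub>V\<^esub> r (S #>\<^bsub>V\<^esub> x)" by (auto simp: r_coset_def)
    then show ?thesis using r(2)[OF coset[OF x]] by (metis S.mem_carrier V.inv_solve_right x)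
  qed
  have shift: "S #>\<^bsub>V\<^esub> (i h \<otimes>\<^bsub>V\<^esub> x) = S #>\<^bsub>V\<^esub> x" if "h \<in> carrier E" "x \<in> carrier V" for h x
  proof -
    have "i h \<in> S" using that by (simp add: S_def)
    then have "i h \<otimes>\<^bsub>V\<^esub> x \<in> S #>\<^bsub>V\<^esub> x" by (auto simp: r_coset_def)
    then show ?thesis using that V.repr_independence S.subgroup_axioms by metis
  qed
  define j where "j = inv_into (carrier E) i"
  have j: "j s \<in> carrier E" "i (j s) = s" if "s \<in> S" for s
    using that by (auto simp: j_def S_def inv_into_into f_inv_into_f)
  have ji: "j (i h) = h" if "h \<in> carrier E" for h
    using that inj by (simp add: j_def)
  \<comment> \<open>Write x as s times the representative of its coset: the first component is s
    pulled back to E, while \<kappa> encodes the coset together with z as one point.\<close>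
  define \<beta> where "\<beta> = (\<lambda>(x, z). (j (x \<otimes>\<^bsub>V\<^esub> inv\<^bsub>V\<^esub> r (S #>\<^bsub>V\<^esub> x)), \<kappa> (S #>\<^bsub>V\<^esub> x, z)))"
  have "bij_betw \<beta> (carrier V \<times> UNIV) (carrier E \<times> UNIV)"
  proof (rule bij_betw_imageI)
    show "inj_on \<beta> (carrier V \<times> UNIV)"
    proof (rule inj_onI, clarify)
      fix x z x' z' assume x: "x \<in> carrier V" "x' \<in> carrier V" and eq: "\<beta> (x, z) = \<beta> (x', z')"
      have "\<kappa> (S #>\<^bsub>V\<^esub> x, z) = \<kappa> (S #>\<^bsub>V\<^esub> x', z')" using eq by (simp add: \<beta>_def)
      from inj_onD[OF bij_betw_imp_inj_on[OF \<kappa>] this] coset x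
      have c: "S #>\<^bsub>V\<^esub> x = S #>\<^bsub>V\<^esub> x'" and z: "z = z'" by simp_all
      have "j (x \<otimes>\<^bsub>V\<^esub> inv\<^bsub>V\<^esub> r (S #>\<^bsub>V\<^esub> x)) = j (x' \<otimes>\<^bsub>V\<^esub> inv\<^bsub>V\<^esub> r (S #>\<^bsub>V\<^esub> x'))"
        using eq by (simp add: \<beta>_def)
      from arg_cong[OF this, of i]
      have "x \<otimes>\<^bsub>V\<^esub> inv\<^bsub>V\<^esub> r (S #>\<^bsub>V\<^esub> x) = x' \<otimes>\<^bsub>V\<^esub> inv\<^bsub>V\<^esub> r (S #>\<^bsub>V\<^esub> x)"
        unfolding j(2)[OF div[OF x(1)]] j(2)[OF div[OF x(2)]] unfolding c .
      then have "x = x'"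
        using V.right_cancel[OF V.inv_closed[OF r(2)[OF coset[OF x(1)]]] x] by simp
      with z show "x = x' \<and> z = z'" by simp
    qed
    show "\<beta> ` (carrier V \<times> UNIV) = carrier E \<times> UNIV"
    proof
      show "\<beta> ` (carrier V \<times> UNIV) \<subseteq> carrier E \<times> UNIV"
        by (auto simp: \<beta>_def intro!: j(1) div)
      show "carrier E \<times> UNIV \<subseteq> \<beta> ` (carrier V \<times> UNIV)"
      proof clarify
        fix h z assume h: "h \<in> carrier E"
        \<comment> \<open>For a preimage of (h, z), decode z into a coset R and a point y; then
          \<open>i h\<close> times the representative of R, paired with y, is sent to (h,
          z).\<close>
        have "z \<in> \<kappa> ` ((rcosets\<^bsub>V\<^esub> S) \<times> UNIV)" using \<kappa> by (simp add: bij_betw_def)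
        then obtain R y where R: "R \<in> rcosets\<^bsub>V\<^esub> S" "\<kappa> (R, y) = z"
          by (auto elim!: imageE)
        have x: "i h \<otimes>\<^bsub>V\<^esub> r R \<in> carrier V" using h r(2)[OF R(1)] by simp
        have "\<beta> (i h \<otimes>\<^bsub>V\<^esub> r R, y) = (h, z)"
          using R r[OF R(1)] h by (simp add: \<beta>_def shift V.m_assoc ji)
        then show "(h, z) \<in> \<beta> ` (carrier V \<times> UNIV)" using x by (intro image_eqI[of _ _ "(i h \<otimes>\<^bsub>V\<^esub> r R, y)"]) auto
      qed
    qed
  qed
  moreover have "\<beta> (i h \<otimes>\<^bsub>V\<^esub> x, z) = (h \<otimes>\<^bsub>E\<^esub> fst (\<beta> (x, z)), snd (\<beta> (x, z)))"
    if "h \<in> carrier E" "x \<in> carrier V" for h x z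
  proof -
    have "i h \<otimes>\<^bsub>V\<^esub> x \<otimes>\<^bsub>V\<^esub> inv\<^bsub>V\<^esub> r (S #>\<^bsub>V\<^esub> x) =
        i (h \<otimes>\<^bsub>E\<^esub> j (x \<otimes>\<^bsub>V\<^esub> inv\<^bsub>V\<^esub> r (S #>\<^bsub>V\<^esub> x)))"
      using that j[OF div[OF that(2)]] r(2)[OF coset[OF that(2)]] by (simp add: V.m_assoc)
    then show ?thesis using that j(1)[OF div[OF that(2)]] by (simp add: \<beta>_def shift ji del: i.hom_mult)
  qed
  ultimately show thesis by (rule that)
qed

text \<open>The action is left multiplication on the first factor of V times Z, transported to Z.
  The quantifier over E and i stands inside the one over \<phi> because a single action of a vertex
  group must serve all edges that end there.\<close>

lemma free_perm_rep:
  fixes V :: "'g monoid"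
  assumes V: "group V" and Z: "infinite (UNIV :: 'z set)" and \<iota>: "inj_on (\<iota> :: 'g \<Rightarrow> 'z) (carrier V)"
  shows "\<exists>\<phi>. \<phi> \<in> mon V (perm_group :: ('z \<Rightarrow> 'z) monoid) \<and>
    (\<forall>(E :: 'h monoid) i. group E \<longrightarrow> i \<in> mon E V \<longrightarrow>
      (\<exists>\<psi>. bij_betw \<psi> UNIV (carrier E \<times> (UNIV :: 'z set)) \<and>
        (\<forall>h\<in>carrier E. \<forall>z. \<psi> (\<phi> (i h) z) = (h \<otimes>\<^bsub>E\<^esub> fst (\<psi> z), snd (\<psi> z)))))"
proof -
  interpret V: group V by fact
  obtain \<theta>' where "bij_betw \<theta>' (carrier V \<times> (UNIV :: 'z set)) (UNIV :: 'z set)"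
    by (rule bij_betw_Times_infinite[OF Z V.carrier_not_empty \<iota>])
  then obtain \<theta> where \<theta>: "bij_betw \<theta> (UNIV :: 'z set) (carrier V \<times> (UNIV :: 'z set))"
    using bij_betw_inv by blast
  have \<theta>_closed: "fst (\<theta> z) \<in> carrier V" for z
    using bij_betwE[OF \<theta>] by (simp add: mem_Times_iff)
  have \<theta>_eqI: "z = z'" if "\<theta> z = \<theta> z'" for z z'
    using \<theta> that by (auto simp: bij_betw_def dest: injD)
  define \<phi> where "\<phi> g z = inv_into UNIV \<theta> (g \<otimes>\<^bsub>V\<^esub> fst (\<theta> z), snd (\<theta> z))" for g z
  have \<theta>\<phi>: "\<theta> (\<phi> g z) = (g \<otimes>\<^bsub>V\<^esub> fst (\<theta> z), snd (\<theta> z))" if "g \<in> carrier V" for g z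
  proof -
    have "(g \<otimes>\<^bsub>V\<^esub> fst (\<theta> z), snd (\<theta> z)) \<in> range \<theta>"
      using \<theta> \<theta>_closed that by (auto simp: bij_betw_def)
    then show ?thesis unfolding \<phi>_def by (rule f_inv_into_f)
  qed
  have \<phi>_mult: "\<phi> (g \<otimes>\<^bsub>V\<^esub> g') = \<phi> g \<circ> \<phi> g'" if "g \<in> carrier V" "g' \<in> carrier V" for g g'
    by (rule ext, rule \<theta>_eqI) (simp add: \<theta>\<phi> that V.m_assoc \<theta>_closed)
  have \<phi>_one: "\<phi> \<one>\<^bsub>V\<^esub> = id"
    by (rule ext, rule \<theta>_eqI) (simp add: \<theta>\<phi> \<theta>_closed)
  have "bij (\<phi> g)" if g: "g \<in> carrier V" for g
    by (rule o_bij[of "\<phi> (inv\<^bsub>V\<^esub> g)"]) (simp_all add: \<phi>_mult[symmetric] g \<phi>_one)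
  then have "\<phi> \<in> hom V (perm_group :: ('z \<Rightarrow> 'z) monoid)"
    by (intro homI) (auto simp: perm_group_def \<phi>_mult)
  moreover have "inj_on \<phi> (carrier V)"
  proof (rule inj_onI)
    fix g g' assume g: "g \<in> carrier V" "g' \<in> carrier V" and eq: "\<phi> g = \<phi> g'"
    \<comment> \<open>The action is free, so comparing the two permutations at one arbitrary point,
      here \<open>undefined\<close>, already separates g from g'.\<close>
    then have "g \<otimes>\<^bsub>V\<^esub> fst (\<theta> undefined) = g' \<otimes>\<^bsub>V\<^esub> fst (\<theta> undefined)"
      using \<theta>\<phi>[of g undefined] \<theta>\<phi>[of g' undefined] by simp
    then show "g = g'" using g \<theta>_closed by simp
  qed
  moreover have "\<exists>\<psi>. bij_betw \<psi> UNIV (carrier E \<times> (UNIV :: 'z set)) \<and>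
        (\<forall>h\<in>carrier E. \<forall>z. \<psi> (\<phi> (i h) z) = (h \<otimes>\<^bsub>E\<^esub> fst (\<psi> z), snd (\<psi> z)))"
    if E: "group E" and i: "i \<in> mon E V" for E :: "'h monoid" and i
  proof -
    obtain \<beta> :: "'g \<times> 'z \<Rightarrow> 'h \<times> 'z"
      where \<beta>: "bij_betw \<beta> (carrier V \<times> UNIV) (carrier E \<times> UNIV)"
        "\<And>h x z. h \<in> carrier E \<Longrightarrow> x \<in> carrier V \<Longrightarrow>
          \<beta> (i h \<otimes>\<^bsub>V\<^esub> x, z) = (h \<otimes>\<^bsub>E\<^esub> fst (\<beta> (x, z)), snd (\<beta> (x, z)))"
      using equivariant_bij[OF V E i Z \<iota>] by blast
    have "i h \<in> carrier V" if "h \<in> carrier E" for h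
      using i that by (auto simp: mon_def hom_def)
    then have "\<forall>h\<in>carrier E. \<forall>z. (\<beta> \<circ> \<theta>) (\<phi> (i h) z) =
        (h \<otimes>\<^bsub>E\<^esub> fst ((\<beta> \<circ> \<theta>) z), snd ((\<beta> \<circ> \<theta>) z))"
      using \<beta>(2) \<theta>_closed by (simp add: \<theta>\<phi>)
    with bij_betw_trans[OF \<theta> \<beta>(1)] show ?thesis by blast
  qed
  ultimately show ?thesis by (intro exI[of _ \<phi>]) (auto simp: mon_def)
qed

context graph_of_groups
begin

text \<open>
  Each \<open>G\<^sub>v\<close> acts freely on an infinite set \<open>Z\<close>, identified with \<open>G\<^sub>v \<times> Z\<close>. The two actions of an edge
  group \<open>G\<^sub>e\<close> that result are both isomorphic to \<open>G\<^sub>e \<times> Z\<close>, hence conjugate, and a conjugating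
  bijection is a value for the edge \<open>e\<close>.
\<close>

lemma faithful_rep_exists:
  obtains \<phi> t where "gog_rep \<G> (perm_group :: (nat \<times> 'g \<Rightarrow> nat \<times> 'g) monoid) \<phi> t"
    and "\<And>v. v \<in> verts (gr \<G>) \<Longrightarrow> inj_on (\<phi> v) (carrier (vgrp \<G> v))"
proof -
  let ?A = "perm_group :: (nat \<times> 'g \<Rightarrow> nat \<times> 'g) monoid"
  \<comment> \<open>The factor \<open>nat\<close> makes the permuted type infinite even if the
    vertex groups are finite; the factor \<open>'g\<close> makes room for every vertex
    group.\<close>
  have Z: "infinite (UNIV :: (nat \<times> 'g) set)" by (simp add: finite_prod)
  have \<iota>: "inj_on (Pair (0 :: nat)) (carrier V)" for V :: "'g monoid"
    by (rule inj_onI) simp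
  let ?P = "\<lambda>v f. f \<in> mon (vgrp \<G> v) ?A \<and>
    (\<forall>(E :: 'h monoid) i. group E \<longrightarrow> i \<in> mon E (vgrp \<G> v) \<longrightarrow>
      (\<exists>\<psi>. bij_betw \<psi> UNIV (carrier E \<times> (UNIV :: (nat \<times> 'g) set)) \<and>
        (\<forall>h\<in>carrier E. \<forall>z. \<psi> (f (i h) z) = (h \<otimes>\<^bsub>E\<^esub> fst (\<psi> z), snd (\<psi> z)))))"
  have "\<forall>v\<in>verts (gr \<G>). \<exists>f. ?P v f"
    using free_perm_rep[OF vgrp_group Z \<iota>] by blast
  from bchoice[OF this] obtain \<phi> where \<phi>: "\<forall>v\<in>verts (gr \<G>). ?P v (\<phi> v)" by blast
  let ?Q = "\<lambda>e \<psi>. bij_betw \<psi> UNIV (carrier (egrp \<G> e) \<times> (UNIV :: (nat \<times> 'g) set)) \<and>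
        (\<forall>h\<in>carrier (egrp \<G> e). \<forall>z. \<psi> (\<phi> (head (gr \<G>) e) (inc \<G> e h) z) =
          (h \<otimes>\<^bsub>egrp \<G> e\<^esub> fst (\<psi> z), snd (\<psi> z)))"
  have "\<forall>e\<in>arcs (gr \<G>). \<exists>\<psi>. ?Q e \<psi>"
    using \<phi> inc_mon egrp_group by simp
  from bchoice[OF this] obtain \<psi> where Q: "\<forall>e\<in>arcs (gr \<G>). ?Q e (\<psi> e)" by blast
  have \<psi>: "bij_betw (\<psi> e) UNIV (carrier (egrp \<G> e) \<times> (UNIV :: (nat \<times> 'g) set))"
    if "e \<in> arcs (gr \<G>)" for e
    using Q that by blast
  have \<psi>\<phi>: "\<psi> e (\<phi> (head (gr \<G>) e) (inc \<G> e h) z) =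
      (h \<otimes>\<^bsub>egrp \<G> e\<^esub> fst (\<psi> e z), snd (\<psi> e z))"
    if "e \<in> arcs (gr \<G>)" "h \<in> carrier (egrp \<G> e)" for e h z
    using Q that by blast
  \<comment> \<open>Both \<psi> at e and \<psi> at the reversed edge have the edge group times Z as
    target, because an edge and its reverse share their group. Going up along the first and down
    along the second carries the action at the head to the action at the tail; exchanging e with its
    reverse inverts this map.\<close>
  define t where "t e z = inv_into UNIV (\<psi> (arev \<G> e)) (\<psi> e z)" for e z
  have \<psi>t: "\<psi> (arev \<G> e) (t e z) = \<psi> e z" if "e \<in> arcs (gr \<G>)" for e z
  proof -
    have "\<psi> e z \<in> range (\<psi> (arev \<G> e))"
      using \<psi>[OF that] \<psi>[of "arev \<G> e"] that by (auto simp: bij_betw_def egrp_arev)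
    then show ?thesis unfolding t_def by (rule f_inv_into_f)
  qed
  have \<psi>_eqI: "z = z'" if "e \<in> arcs (gr \<G>)" "\<psi> e z = \<psi> e z'" for e z z'
    using \<psi>[OF that(1)] that(2) by (auto simp: bij_betw_def dest: injD)
  have tt: "t (arev \<G> e) \<circ> t e = id" if e: "e \<in> arcs (gr \<G>)" for e
    by (rule ext, rule \<psi>_eqI[OF e]) (use \<psi>t[of e] \<psi>t[of "arev \<G> e"] e in simp)
  have bij: "bij (t e)" if e: "e \<in> arcs (gr \<G>)" for e
    using tt[OF e] tt[of "arev \<G> e"] e by (intro o_bij[of "t (arev \<G> e)"]) auto
  have "gog_rep \<G> ?A \<phi> t"
  proof (intro gog_rep.intro gog_rep_axioms.intro graph_of_groups_axioms group_perm_group)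
    show "\<phi> v \<in> hom (vgrp \<G> v) ?A" if "v \<in> verts (gr \<G>)" for v
      using \<phi> that by (simp add: mon_def)
    show "t e \<in> carrier ?A" if "e \<in> arcs (gr \<G>)" for e
      using bij[OF that] by (simp add: perm_group_def)
    show "t (arev \<G> e) = inv\<^bsub>?A\<^esub> (t e)" if e: "e \<in> arcs (gr \<G>)" for e
      by (rule group.inv_equality[OF group_perm_group, symmetric])
        (use tt[OF e] bij e in \<open>simp_all add: perm_group_def\<close>)
    show "t e \<otimes>\<^bsub>?A\<^esub> \<phi> (head (gr \<G>) e) (inc \<G> e h) =
      \<phi> (tail (gr \<G>) e) (inc \<G> (arev \<G> e) h) \<otimes>\<^bsub>?A\<^esub> t e"
      if e: "e \<in> arcs (gr \<G>)" and h: "h \<in> carrier (egrp \<G> e)" for e h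
    proof -
      have r: "arev \<G> e \<in> arcs (gr \<G>)" using e by simp
      have "t e (\<phi> (head (gr \<G>) e) (inc \<G> e h) z) =
          \<phi> (tail (gr \<G>) e) (inc \<G> (arev \<G> e) h) (t e z)" for z
        by (rule \<psi>_eqI[OF r]) (use e h \<psi>\<phi>[OF r, of h "t e z"] in \<open>simp add: \<psi>t \<psi>\<phi> egrp_arev\<close>)
      then show ?thesis by (auto simp: perm_group_def)
    qed
  qed
  moreover have "inj_on (\<phi> v) (carrier (vgrp \<G> v))" if "v \<in> verts (gr \<G>)" for v
    using \<phi> that by (simp add: mon_def)
  ultimately show thesis by (rule that)
qed

end

section \<open>Collapsing a subgraph\<close>

context graph_of_groups
begin

lemma reachable_imp_is_path:
  assumes "u \<rightarrow>\<^sup>*\<^bsub>gr \<G>\<^esub> v"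
  shows "\<exists>p. is_path \<G> u p v"
  using assms
proof (induction rule: converse_reachable_induct)
  case base
  then show ?case using is_path_one by blast
next
  case (step x y)
  from step(1) obtain e where "e \<in> arcs (gr \<G>)" "tail (gr \<G>) e = x" "head (gr \<G>) e = y" by blast
  moreover from step obtain g s where "is_path \<G> y (g, s) v" by auto
  ultimately have "is_path \<G> x (\<one>\<^bsub>vgrp \<G> x\<^esub>, (e, g) # s) v"
    using vgrp_one_closed by auto
  then show ?case by blast
qed

lemma strongly_connected: "strongly_connected (gr \<G>)"
  using symmetric_connected_imp_strongly_connected connected sym_arcs by blast

end

section \<open>Classes of paths closed up by links to a base point\<close>

locale based_gog = graph_of_groups \<G> for \<G> :: "('v, 'e, 'g, 'h) gog" +
  fixes b :: 'v and lk :: "'v \<Rightarrow> ('g, 'e) gpath"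
  assumes lk_path: "v \<in> verts (gr \<G>) \<Longrightarrow> is_path \<G> b (lk v) v"
    and b_vert: "b \<in> verts (gr \<G>)"
begin

text \<open>This is the groupoid homomorphism onto the group at \<open>b\<close> determined by the
  links. Nothing makes the link of \<open>b\<close> itself trivial, so loops at \<open>b\<close> may
  be conjugated by it. For one component it is what \<open>linked_class\<close> computes.\<close>

definition cls :: "'v \<Rightarrow> ('g, 'e) gpath \<Rightarrow> 'v \<Rightarrow> ('g, 'e) gpath set" where
  "cls u p v = loop_class \<G> b (path_cat \<G> b (lk u) (path_cat \<G> u p (path_rev \<G> b (lk v))))"

lemma is_path_linked:
  assumes "is_path \<G> u p v"
  shows "is_path \<G> b (path_cat \<G> b (lk u) (path_cat \<G> u p (path_rev \<G> b (lk v)))) b"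
  using is_path_verts[OF assms]
  by (intro is_path_cat[OF lk_path is_path_cat[OF assms is_path_rev[OF lk_path]]])

lemma cls_closed: "is_path \<G> u p v \<Longrightarrow> cls u p v \<in> carrier (pi1 \<G> b)"
  unfolding cls_def pi1_carrier using is_path_linked by blast

lemma cls_homotopic:
  assumes "homotopic \<G> u v p q"
  shows "cls u p v = cls u q v"
proof -
  note p = homotopic_is_path(1)[OF assms]
  have "homotopic \<G> b b (path_cat \<G> b (lk u) (path_cat \<G> u p (path_rev \<G> b (lk v))))
      (path_cat \<G> b (lk u) (path_cat \<G> u q (path_rev \<G> b (lk v))))"
    using is_path_verts[OF p] by (intro homotopic_cat_cong[OF assms] lk_path is_path_rev)
  then show ?thesis unfolding cls_def by (simp add: loop_class_eq_iff is_path_linked[OF p])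
qed

text \<open>Between the two factors the reversed link to v meets the link to v, and the two cancel
  up to homotopy.\<close>

lemma cls_mult:
  assumes p: "is_path \<G> u p v" and q: "is_path \<G> v q w"
  shows "cls u p v \<otimes>\<^bsub>pi1 \<G> b\<^esub> cls v q w = cls u (path_cat \<G> u p q) w"
proof -
  note lu = lk_path[OF is_path_verts(1)[OF p]] and lv = lk_path[OF is_path_verts(2)[OF p]]
  note r = is_path_rev[OF lv] and rw = is_path_rev[OF lk_path[OF is_path_verts(2)[OF q]]]
  let ?l = "lk v" and ?r = "path_rev \<G> b (lk v)" and ?q = "path_cat \<G> v q (path_rev \<G> b (lk w))"
  let ?p = "path_cat \<G> b (lk u) p"
  note P = is_path_cat[OF lu p] and Q = is_path_cat[OF q rw]
  have "path_cat \<G> b (path_cat \<G> b (lk u) (path_cat \<G> u p ?r)) (path_cat \<G> b ?l ?q) =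
      path_cat \<G> b ?p (path_cat \<G> v ?r (path_cat \<G> b ?l ?q))"
    using path_cat_assoc[OF lu p r] path_cat_assoc[OF P r is_path_cat[OF lv Q]] by simp
  also have "path_cat \<G> v ?r (path_cat \<G> b ?l ?q) = path_cat \<G> v (path_cat \<G> v ?r ?l) ?q"
    using path_cat_assoc[OF r lv Q] by simp
  finally have eq: "path_cat \<G> b (path_cat \<G> b (lk u) (path_cat \<G> u p ?r)) (path_cat \<G> b ?l ?q) =
      path_cat \<G> b ?p (path_cat \<G> v (path_cat \<G> v ?r ?l) ?q)" .
  have "homotopic \<G> b b (path_cat \<G> b ?p (path_cat \<G> v (path_cat \<G> v ?r ?l) ?q))
      (path_cat \<G> b ?p (path_cat \<G> v (\<one>\<^bsub>vgrp \<G> v\<^esub>, []) ?q))"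
    by (rule homotopic_cat_cong[OF homotopic_rev_cat[OF lv] P Q])
  moreover have "path_cat \<G> b ?p (path_cat \<G> v (\<one>\<^bsub>vgrp \<G> v\<^esub>, []) ?q) =
      path_cat \<G> b (lk u) (path_cat \<G> u (path_cat \<G> u p q) (path_rev \<G> b (lk w)))"
    using path_cat_one_left[OF Q] path_cat_assoc[OF lu p Q] path_cat_assoc[OF p q rw] by simp
  ultimately have h: "homotopic \<G> b b
      (path_cat \<G> b (path_cat \<G> b (lk u) (path_cat \<G> u p ?r)) (path_cat \<G> b ?l ?q))
      (path_cat \<G> b (lk u) (path_cat \<G> u (path_cat \<G> u p q) (path_rev \<G> b (lk w))))"
    unfolding eq by simp
  show ?thesis
    unfolding cls_def pi1_mult[OF is_path_linked[OF p] is_path_linked[OF q]]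
    by (subst loop_class_eq_iff) (rule homotopic_is_path(1)[OF h], rule h)
qed

lemma cls_one:
  assumes "v \<in> verts (gr \<G>)"
  shows "cls v (\<one>\<^bsub>vgrp \<G> v\<^esub>, []) v = \<one>\<^bsub>pi1 \<G> b\<^esub>"
  unfolding cls_def pi1_one path_cat_one_left[OF is_path_rev[OF lk_path[OF assms]]]
  by (subst loop_class_eq_iff)
    (auto intro: is_path_cat is_path_rev lk_path assms homotopic_cat_rev simp del: path_cat.simps)

text \<open>This is the edge relation read inside the fundamental group. It later makes the
  homomorphism on a collapsed edge independent of the orientation.\<close>

lemma cls_slide:
  assumes e: "e \<in> arcs (gr \<G>)" and h: "h \<in> carrier (egrp \<G> e)"
  shows "cls (tail (gr \<G>) e) (inc \<G> (arev \<G> e) h, []) (tail (gr \<G>) e) \<otimes>\<^bsub>pi1 \<G> b\<^esub>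
      cls (tail (gr \<G>) e) (\<one>\<^bsub>vgrp \<G> (tail (gr \<G>) e)\<^esub>, [(e, \<one>\<^bsub>vgrp \<G> (head (gr \<G>) e)\<^esub>)]) (head (gr \<G>) e) =
    cls (tail (gr \<G>) e) (\<one>\<^bsub>vgrp \<G> (tail (gr \<G>) e)\<^esub>, [(e, \<one>\<^bsub>vgrp \<G> (head (gr \<G>) e)\<^esub>)]) (head (gr \<G>) e)
      \<otimes>\<^bsub>pi1 \<G> b\<^esub> cls (head (gr \<G>) e) (inc \<G> e h, []) (head (gr \<G>) e)"
proof -
  let ?w = "tail (gr \<G>) e" and ?x = "head (gr \<G>) e"
  have w: "?w \<in> verts (gr \<G>)" and x: "?x \<in> verts (gr \<G>)" using e by auto
  note ow = is_path_one[OF w] and ox = is_path_one[OF x]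
  note s = is_path_slide[OF e h]
  have ep: "is_path \<G> ?w (\<one>\<^bsub>vgrp \<G> ?w\<^esub>, [(e, \<one>\<^bsub>vgrp \<G> ?x\<^esub>)]) ?x"
    using e ow ox by simp
  have hp: "is_path \<G> ?w (inc \<G> (arev \<G> e) h, []) ?w" "is_path \<G> ?x (inc \<G> e h, []) ?x"
    using inc_closed inc_arev_closed e h by simp_all
  have c1: "path_cat \<G> ?w (inc \<G> (arev \<G> e) h, []) (\<one>\<^bsub>vgrp \<G> ?w\<^esub>, [(e, \<one>\<^bsub>vgrp \<G> ?x\<^esub>)]) =
      (inc \<G> (arev \<G> e) h, [(e, \<one>\<^bsub>vgrp \<G> ?x\<^esub>)])"
    using path_cat_append[OF hp(1)] by simp
  have c2: "path_cat \<G> ?w (\<one>\<^bsub>vgrp \<G> ?w\<^esub>, [(e, \<one>\<^bsub>vgrp \<G> ?x\<^esub>)]) (inc \<G> e h, []) =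
      (\<one>\<^bsub>vgrp \<G> ?w\<^esub>, [(e, inc \<G> e h)])"
    using path_cat_one_left[OF hp(2)] by simp
  have "homotopic \<G> ?w ?x (\<one>\<^bsub>vgrp \<G> ?w\<^esub>, [(e, inc \<G> e h)])
      (inc \<G> (arev \<G> e) h, [(e, \<one>\<^bsub>vgrp \<G> ?x\<^esub>)])"
    using homotopic.slide[OF e HOL.refl HOL.refl h ow ox] path_cat_one_right[OF s(1)]
      path_cat_one_right[OF s(2)] path_cat_one_left[OF s(1)] path_cat_one_left[OF s(2)]
    by (simp del: path_cat.simps)
  from cls_homotopic[OF this] show ?thesis
    unfolding cls_mult[OF hp(1) ep] cls_mult[OF ep hp(2)] c1 c2 by simp
qed

lemma cls_arev:
  assumes e: "e \<in> arcs (gr \<G>)"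
  shows "cls (head (gr \<G>) e) (\<one>\<^bsub>vgrp \<G> (head (gr \<G>) e)\<^esub>, [(arev \<G> e, \<one>\<^bsub>vgrp \<G> (tail (gr \<G>) e)\<^esub>)]) (tail (gr \<G>) e) =
    inv\<^bsub>pi1 \<G> b\<^esub> (cls (tail (gr \<G>) e) (\<one>\<^bsub>vgrp \<G> (tail (gr \<G>) e)\<^esub>, [(e, \<one>\<^bsub>vgrp \<G> (head (gr \<G>) e)\<^esub>)]) (head (gr \<G>) e))"
proof -
  let ?w = "tail (gr \<G>) e" and ?x = "head (gr \<G>) e"
  have w: "?w \<in> verts (gr \<G>)" and x: "?x \<in> verts (gr \<G>)" using e by auto
  interpret P: group "pi1 \<G> b" using b_vert by (rule group_pi1)
  have ep: "is_path \<G> ?w (\<one>\<^bsub>vgrp \<G> ?w\<^esub>, [(e, \<one>\<^bsub>vgrp \<G> ?x\<^esub>)]) ?x"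
    using e is_path_one[OF w] is_path_one[OF x] by simp
  have r: "path_rev \<G> ?w (\<one>\<^bsub>vgrp \<G> ?w\<^esub>, [(e, \<one>\<^bsub>vgrp \<G> ?x\<^esub>)]) =
      (\<one>\<^bsub>vgrp \<G> ?x\<^esub>, [(arev \<G> e, \<one>\<^bsub>vgrp \<G> ?w\<^esub>)])"
    using w x by (simp add: group.is_monoid monoid.inv_one vgrp_group)
  note rp = is_path_rev[OF ep]
  have "cls ?x (path_rev \<G> ?w (\<one>\<^bsub>vgrp \<G> ?w\<^esub>, [(e, \<one>\<^bsub>vgrp \<G> ?x\<^esub>)])) ?w \<otimes>\<^bsub>pi1 \<G> b\<^esub>
      cls ?w (\<one>\<^bsub>vgrp \<G> ?w\<^esub>, [(e, \<one>\<^bsub>vgrp \<G> ?x\<^esub>)]) ?x = \<one>\<^bsub>pi1 \<G> b\<^esub>"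
    unfolding cls_mult[OF rp ep] cls_homotopic[OF homotopic_rev_cat[OF ep]] by (rule cls_one[OF x])
  from P.inv_equality[OF this cls_closed[OF ep] cls_closed[OF rp]] show ?thesis unfolding r by simp
qed

text \<open>This is the embedding of vertex groups into the fundamental group. Under a
  representation faithful on vertex groups, equal classes have equal values; the values of the link
  and of its reversal cancel, leaving equal values of g and g'.\<close>

lemma cls_vertex_mon:
  assumes v: "v \<in> verts (gr \<G>)"
  shows "(\<lambda>g. cls v (g, []) v) \<in> mon (vgrp \<G> v) (pi1 \<G> b)"
proof -
  have p: "is_path \<G> v (g, []) v" if "g \<in> carrier (vgrp \<G> v)" for g using that v by simp
  have "(\<lambda>g. cls v (g, []) v) \<in> hom (vgrp \<G> v) (pi1 \<G> b)"
    using v by (intro homI) (simp_all add: cls_closed cls_mult)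
  moreover have "inj_on (\<lambda>g. cls v (g, []) v) (carrier (vgrp \<G> v))"
  proof (rule inj_onI)
    fix g g' assume g: "g \<in> carrier (vgrp \<G> v)" "g' \<in> carrier (vgrp \<G> v)"
      and eq: "cls v (g, []) v = cls v (g', []) v"
    obtain \<phi> t where rep: "gog_rep \<G> (perm_group :: (nat \<times> 'g \<Rightarrow> nat \<times> 'g) monoid) \<phi> t"
      and inj: "\<And>v. v \<in> verts (gr \<G>) \<Longrightarrow> inj_on (\<phi> v) (carrier (vgrp \<G> v))"
      using faithful_rep_exists by blast
    interpret gog_rep \<G> "perm_group :: (nat \<times> 'g \<Rightarrow> nat \<times> 'g) monoid" \<phi> t by (fact rep)
    note l = lk_path[OF v] and r = is_path_rev[OF lk_path[OF v]]
    from eq have "path_val b (path_cat \<G> b (lk v) (path_cat \<G> v (g, []) (path_rev \<G> b (lk v)))) =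
        path_val b (path_cat \<G> b (lk v) (path_cat \<G> v (g', []) (path_rev \<G> b (lk v))))"
      unfolding cls_def using loop_class_eq_iff[OF is_path_linked[OF p[OF g(1)]]] path_val_homotopic
      by blast
    then have "\<phi> v g = \<phi> v g'"
      using path_val_cat[OF l is_path_cat[OF p[OF g(1)] r]] path_val_cat[OF p[OF g(1)] r]
        path_val_cat[OF l is_path_cat[OF p[OF g(2)] r]] path_val_cat[OF p[OF g(2)] r]
        path_val_closed[OF l] path_val_closed[OF r] \<phi>_closed[OF v] g
      by (simp del: path_cat.simps)
    with inj[OF v] g show "g = g'" by (auto dest: inj_onD)
  qed
  ultimately show ?thesis by (simp add: mon_def)
qed

end

section \<open>Components of a spanning subgraph\<close>

locale spanning_subgraph = graph_of_groups \<L> for \<L> :: "('v, 'e, 'g, 'h) gog" +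
  fixes H :: "('v, 'e) pre_digraph"
  assumes verts_H: "verts H = verts (gr \<L>)"
    and arcs_H: "arcs H \<subseteq> arcs (gr \<L>)"
    and tail_H: "tail H = tail (gr \<L>)"
    and head_H: "head H = head (gr \<L>)"
    and arev_H: "e \<in> arcs H \<Longrightarrow> arev \<L> e \<in> arcs H"
begin

lemma arcs_HD: "e \<in> arcs H \<Longrightarrow> e \<in> arcs (gr \<L>)"
  using arcs_H by blast

lemma arev_H_iff: "arev \<L> e \<in> arcs H \<longleftrightarrow> e \<in> arcs H"
  using arev_H[of e] arev_H[of "arev \<L> e"] by auto

sublocale H: sym_digraph H
proof
  show "tail H e \<in> verts H" "head H e \<in> verts H" if "e \<in> arcs H" for e
    using arcs_HD[OF that] by (simp_all add: verts_H tail_H head_H)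
  show "symmetric H"
    unfolding symmetric_conv
  proof
    fix e assume "e \<in> arcs H"
    then show "\<exists>e'\<in>arcs H. tail H e = head H e' \<and> head H e = tail H e'"
      by (intro bexI[of _ "arev \<L> e"]) (auto simp: arcs_HD tail_H head_H arev_H)
  qed
qed

abbreviation "scc v \<equiv> pre_digraph.scc_of H v"
abbreviation "K C \<equiv> component_gog \<L> H C"

lemma K_sel [simp]: "gr (K C) = H \<restriction> C" "vgrp (K C) = vgrp \<L>" "egrp (K C) = egrp \<L>"
  "inc (K C) = inc \<L>" "arev (K C) = perm_restrict (arev \<L>) (arcs (H \<restriction> C))"
  by (simp_all add: component_gog_def restrict_gog_def)

lemma scc_tail:
  assumes "e \<in> arcs H"
  shows "scc (tail (gr \<L>) e) = scc (head (gr \<L>) e)"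
proof -
  have "tail H e \<rightarrow>\<^bsub>H\<^esub> head H e" using assms by (auto simp: arcs_ends_conv)
  then have "tail H e \<in> scc (head H e)" by (intro H.scc_ofI_reachable) auto
  then show ?thesis using H.scc_of_eq tail_H head_H by metis
qed

lemma scc_eq:
  assumes "C \<in> H.sccs_verts" "v \<in> C"
  shows "scc v = C"
proof -
  obtain u where "C = scc u" using assms(1) by (auto simp: H.sccs_verts_conv_scc_of)
  then show ?thesis using assms(2) H.scc_of_eq by blast
qed

lemma scc_in: "v \<in> verts (gr \<L>) \<Longrightarrow> scc v \<in> H.sccs_verts"
  using H.scc_of_in_sccs_verts verts_H by simp

lemma scc_self: "v \<in> verts (gr \<L>) \<Longrightarrow> v \<in> scc v"
  using H.in_scc_of_self verts_H by simp

lemma scc_subset: "C \<in> H.sccs_verts \<Longrightarrow> C \<subseteq> verts (gr \<L>)"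
  using H.sccs_verts_subsets verts_H by simp

lemma arcs_K: "e \<in> arcs (H \<restriction> C) \<longleftrightarrow> e \<in> arcs H \<and> head (gr \<L>) e \<in> C" if "C \<in> H.sccs_verts"
proof -
  have "tail (gr \<L>) e \<in> C" if "e \<in> arcs H" "head (gr \<L>) e \<in> C"
    using scc_eq[OF \<open>C \<in> _\<close> that(2)] scc_tail[OF that(1)] scc_self[of "tail (gr \<L>) e"] arcs_HD that
    by simp
  then show ?thesis by (auto simp: tail_H head_H)
qed

text \<open>Connectedness comes from the component being strongly connected. The reversal is cut
  down to the arcs of the component, since off its arcs a reversal has to be the identity.\<close>

lemma graph_of_groups_K:
  assumes C: "C \<in> H.sccs_verts"
  shows "graph_of_groups (K C)"
proof -
  interpret W: wf_digraph "H \<restriction> C" by blast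
  have rev: "arev \<L> e \<in> arcs (H \<restriction> C)" if "e \<in> arcs (H \<restriction> C)" for e
    using that by (auto simp: arev_H tail_H head_H arcs_HD)
  have eL: "e \<in> arcs (gr \<L>)" if "e \<in> arcs (H \<restriction> C)" for e using that arcs_HD by simp
  have bi: "bidirected_digraph (H \<restriction> C) (perm_restrict (arev \<L>) (arcs (H \<restriction> C)))"
    by (rule W.bidirected_digraphI)
      (use rev arev_neq eL in \<open>auto simp: perm_restrict_def tail_H head_H arcs_HD split: if_splits\<close>)
  have "strongly_connected (H \<restriction> C)"
    using H.in_verts_sccsD_sccs[OF C] by (rule H.in_sccsE)
  then have "connected (H \<restriction> C)"
    by (intro W.connectedI) (auto simp: strongly_connected_def intro: W.reachable_mk_symmetricI)
  with bi show ?thesis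
    using scc_subset[OF C]
    by (intro graph_of_groups.intro graph_of_groups_axioms.intro)
      (auto simp: perm_restrict_def head_H intro!: vgrp_group egrp_group egrp_arev inc_mon arcs_HD)
qed

end

text \<open>Base points and links are separated from the shifts because the shifts are constructed
  from classes of edges, which already presuppose base points and links.\<close>

locale linked_subgraph = spanning_subgraph \<L> H
  for \<L> :: "('v, 'e, 'g, 'h) gog" and H :: "('v, 'e) pre_digraph" +
  fixes \<chi> :: "('v, 'e, 'g) collapse_choice"
  assumes base_in: "C \<in> pre_digraph.sccs_verts H \<Longrightarrow> base \<chi> C \<in> C"
    and link_path: "C \<in> pre_digraph.sccs_verts H \<Longrightarrow> v \<in> C \<Longrightarrow>
      is_path (component_gog \<L> H C) (base \<chi> C) (link \<chi> v) v"
begin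

lemma based_gog_K:
  assumes "C \<in> H.sccs_verts"
  shows "based_gog (K C) (base \<chi> C) (link \<chi>)"
  using assms base_in link_path
  by (intro based_gog.intro based_gog_axioms.intro graph_of_groups_K) auto

lemma linked_class_eq_cls:
  "linked_class \<L> H \<chi> u p v = based_gog.cls (K (scc u)) (base \<chi> (scc u)) (link \<chi>) u p v"
  if "u \<in> verts (gr \<L>)"
  unfolding linked_class_def Let_def based_gog.cls_def[OF based_gog_K[OF scc_in[OF that]]] ..

abbreviation "P v \<equiv> pi1 (K (scc v)) (base \<chi> (scc v))"

abbreviation "vcls v g \<equiv> linked_class \<L> H \<chi> v (g, []) v"

text \<open>The element of the fundamental group traced out by a single edge of \<open>H\<close>.
  The shifts of the edge and its reverse must reproduce it as shift(reverse) times the inverse of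
  shift(edge).\<close>

definition ecls :: "'e \<Rightarrow> ('g, 'e) gpath set" where
  "ecls e = linked_class \<L> H \<chi> (tail (gr \<L>) e)
    (\<one>\<^bsub>vgrp \<L> (tail (gr \<L>) e)\<^esub>, [(e, \<one>\<^bsub>vgrp \<L> (head (gr \<L>) e)\<^esub>)]) (head (gr \<L>) e)"

lemma group_P: "v \<in> verts (gr \<L>) \<Longrightarrow> group (P v)"
  using scc_in base_in by (intro graph_of_groups.group_pi1 graph_of_groups_K) auto

lemma vcls_mon:
  assumes "v \<in> verts (gr \<L>)"
  shows "vcls v \<in> mon (vgrp \<L> v) (P v)"
proof -
  interpret KC: based_gog "K (scc v)" "base \<chi> (scc v)" "link \<chi>"
    by (rule based_gog_K[OF scc_in[OF assms]])
  show ?thesis using KC.cls_vertex_mon[of v] scc_self[OF assms]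
    by (simp add: linked_class_eq_cls[OF assms])
qed

lemma ecls_edge:
  assumes e: "e \<in> arcs H"
  shows ecls_closed: "ecls e \<in> carrier (P (head (gr \<L>) e))"
    and ecls_arev: "ecls (arev \<L> e) = inv\<^bsub>P (head (gr \<L>) e)\<^esub> (ecls e)"
    and ecls_slide: "h \<in> carrier (egrp \<L> e) \<Longrightarrow>
      vcls (tail (gr \<L>) e) (inc \<L> (arev \<L> e) h) \<otimes>\<^bsub>P (head (gr \<L>) e)\<^esub> ecls e =
      ecls e \<otimes>\<^bsub>P (head (gr \<L>) e)\<^esub> vcls (head (gr \<L>) e) (inc \<L> e h)"
proof -
  let ?w = "tail (gr \<L>) e" and ?x = "head (gr \<L>) e"
  note eL = arcs_HD[OF e]
  have w: "?w \<in> verts (gr \<L>)" and x: "?x \<in> verts (gr \<L>)" using eL by auto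
  note C = scc_in[OF x]
  interpret KC: based_gog "K (scc ?x)" "base \<chi> (scc ?x)" "link \<chi>"
    by (rule based_gog_K[OF C])
  have eK: "e \<in> arcs (gr (K (scc ?x)))" using arcs_K[OF C] e scc_self[OF x] by simp
  have rK: "arev (K (scc ?x)) e = arev \<L> e" using eK by (simp add: perm_restrict_def)
  have ep: "is_path (K (scc ?x)) ?w (\<one>\<^bsub>vgrp \<L> ?w\<^esub>, [(e, \<one>\<^bsub>vgrp \<L> ?x\<^esub>)]) ?x"
    using eK vgrp_one_closed w x
      scc_self[OF x] scc_self[OF w] scc_tail[OF e] by (simp add: tail_H head_H)
  show "ecls e \<in> carrier (P ?x)"
    unfolding ecls_def linked_class_eq_cls[OF w] scc_tail[OF e] using KC.cls_closed[OF ep] .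
  show "ecls (arev \<L> e) = inv\<^bsub>P ?x\<^esub> (ecls e)"
    using KC.cls_arev[OF eK, unfolded rK] eL
    by (simp add: ecls_def linked_class_eq_cls w x scc_tail[OF e] tail_H head_H)
  show "vcls ?w (inc \<L> (arev \<L> e) h) \<otimes>\<^bsub>P ?x\<^esub> ecls e = ecls e \<otimes>\<^bsub>P ?x\<^esub> vcls ?x (inc \<L> e h)"
    if "h \<in> carrier (egrp \<L> e)"
    using KC.cls_slide[OF eK, of h, unfolded rK] that
    by (simp add: ecls_def linked_class_eq_cls w x scc_tail[OF e] tail_H head_H)
qed

end

text \<open>The conditions on shifts for different pairs of opposite edges do not interact. Within a
  pair, one orientation receives the unit and the other the class that its condition forces; the
  condition for the opposite orientation then follows since \<open>ecls\<close> turns reversal into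
  inversion.\<close>

lemma (in spanning_subgraph) collapse_choice_exists: "\<exists>\<chi>. is_collapse_choice \<L> H \<chi>"
proof -
  define bs where "bs C = (SOME v. v \<in> C)" for C :: "'v set"
  define ln where "ln v = (SOME p. is_path (K (scc v)) (bs (scc v)) p v)" for v
  \<comment> \<open>The shifts are placeholders: this record serves only to make \<open>ecls\<close>
    available.\<close>
  define \<chi>0 where "\<chi>0 = \<lparr>base = bs, link = ln, shift = (\<lambda>e. {})\<rparr>"
  have bs: "bs C \<in> C" if "C \<in> H.sccs_verts" for C
    using that unfolding bs_def some_in_eq by (simp add: H.in_sccs_verts_conv_reachable)
  have ln: "is_path (K C) (bs C) (ln v) v" if C: "C \<in> H.sccs_verts" and v: "v \<in> C" for C v
  proof -
    interpret KC: graph_of_groups "K C" by (rule graph_of_groups_K[OF C])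
    have "\<exists>p. is_path (K C) (bs C) p v"
      using KC.strongly_connected bs[OF C] v
      by (intro KC.reachable_imp_is_path) (auto simp: strongly_connected_def)
    then show ?thesis unfolding ln_def scc_eq[OF C v] by (rule someI_ex)
  qed
  interpret linked_subgraph \<L> H \<chi>0
    by unfold_locales (simp_all add: \<chi>0_def bs ln)
  \<comment> \<open>an orientation: \<open>e\<close> is positive if \<open>rep e = e\<close>, and gets a trivial shift then\<close>
  define rep where "rep e = (SOME x. x \<in> {e, arev \<L> e})" for e
  have rep: "rep (arev \<L> e) = rep e" "rep e \<in> {e, arev \<L> e}" for e
    unfolding rep_def by (simp add: insert_commute, rule someI, blast)
  define sh where "sh e = (if rep e = e then \<one>\<^bsub>P (head (gr \<L>) e)\<^esub> else ecls (arev \<L> e))" for e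
  define \<chi> where "\<chi> = \<chi>0\<lparr>shift := sh\<rparr>"
  have "is_collapse_choice \<L> H \<chi>"
    unfolding is_collapse_choice_def Let_def
  proof (intro conjI ballI)
    fix C assume C: "C \<in> H.sccs_verts"
    show "base \<chi> C \<in> C" using bs[OF C] by (simp add: \<chi>_def \<chi>0_def)
    show "is_path (K C) (base \<chi> C) (link \<chi> v) v" if "v \<in> C" for v
      using ln[OF C that] by (simp add: \<chi>_def \<chi>0_def)
  next
    fix e assume e: "e \<in> arcs H"
    note eL = arcs_HD[OF e] and r = arev_H[OF e]
    interpret Pg: group "P (head (gr \<L>) e)" using eL by (intro group_P) simp
    have b: "base \<chi> = base \<chi>0" "link \<chi> = link \<chi>0" "shift \<chi> = sh" by (simp_all add: \<chi>_def)
    have rc: "ecls (arev \<L> e) \<in> carrier (P (head (gr \<L>) e))"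
      using ecls_closed[OF r] eL scc_tail[OF e] by simp
    show sc: "shift \<chi> e \<in> carrier (pi1 (K (scc (head H e))) (base \<chi> (scc (head H e))))"
      using rc by (simp add: b sh_def head_H)
    have E: "linked_class \<L> H \<chi> (tail H e) (\<one>\<^bsub>vgrp \<L> (tail H e)\<^esub>, [(e, \<one>\<^bsub>vgrp \<L> (head H e)\<^esub>)])
        (head H e) = ecls e"
      by (simp add: ecls_def linked_class_def b tail_H head_H)
    have "sh (arev \<L> e) \<otimes>\<^bsub>P (head (gr \<L>) e)\<^esub> inv\<^bsub>P (head (gr \<L>) e)\<^esub> (sh e) = ecls e"
    proof (cases "rep e = e")
      case True
      then show ?thesis using arev_neq[OF eL] rep[of e] ecls_closed[OF e] by (simp add: sh_def)
    next
      case False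
      then show ?thesis
        using rep[of e] ecls_closed[OF e] ecls_arev[OF e] eL scc_tail[OF e] by (simp add: sh_def)
    qed
    then show "shift \<chi> (arev \<L> e) \<otimes>\<^bsub>pi1 (K (scc (head H e))) (base \<chi> (scc (head H e)))\<^esub>
        inv\<^bsub>pi1 (K (scc (head H e))) (base \<chi> (scc (head H e)))\<^esub> (shift \<chi> e) =
      linked_class \<L> H \<chi> (tail H e) (\<one>\<^bsub>vgrp \<L> (tail H e)\<^esub>, [(e, \<one>\<^bsub>vgrp \<L> (head H e)\<^esub>)]) (head H e)"
      unfolding E by (simp add: b head_H)
  qed
  then show ?thesis by blast
qed

section \<open>Conjugation identities in a group\<close>

context group
begin

lemma inv_mult_cancel:
  assumes "x \<in> carrier G" "y \<in> carrier G"
  shows "inv x \<otimes> (x \<otimes> y) = y" "x \<otimes> (inv x \<otimes> y) = y"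
  using assms by (simp_all flip: m_assoc)

lemma conj_hom:
  assumes "f \<in> hom B G" "s \<in> carrier G"
  shows "(\<lambda>h. inv s \<otimes> f h \<otimes> s) \<in> hom B G"
proof -
  have c: "f x \<in> carrier G" if "x \<in> carrier B" for x using assms that by (auto simp: hom_def)
  show ?thesis
    using assms(2) c hom_mult[OF assms(1)]
    by (intro homI) (simp_all add: m_assoc inv_mult_cancel)
qed

text \<open>Meant for x and y the images of one edge group element at the tail and head of a
  collapsed edge, and s, s' the shifts of the edge and its reverse: the hypothesis is then the edge
  relation, and the conclusion says that both orientations define the same homomorphism.\<close>

lemma conj_eq:
  assumes "s \<in> carrier G" "s' \<in> carrier G" "x \<in> carrier G" "y \<in> carrier G"
    and "x \<otimes> (s' \<otimes> inv s) = (s' \<otimes> inv s) \<otimes> y"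
  shows "inv s' \<otimes> x \<otimes> s' = inv s \<otimes> y \<otimes> s"
proof -
  have "inv s' \<otimes> x \<otimes> s' = inv s' \<otimes> (x \<otimes> (s' \<otimes> inv s)) \<otimes> s"
    using assms(1-4) by (simp add: m_assoc)
  also have "\<dots> = inv s \<otimes> y \<otimes> s"
    unfolding assms(5) using assms(1-4) by (simp add: m_assoc inv_mult_cancel)
  finally show ?thesis .
qed

end

section \<open>The collapsed graph of groups and the collapse morphism\<close>

locale collapse_data = spanning_subgraph \<L> H
  for \<L> :: "('v, 'e, 'g, 'h) gog" and H :: "('v, 'e) pre_digraph" +
  fixes \<chi> :: "('v, 'e, 'g) collapse_choice"
  assumes choice: "is_collapse_choice \<L> H \<chi>"
begin

sublocale linked_subgraph \<L> H \<chi>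
  using choice by unfold_locales (auto simp: is_collapse_choice_def)

lemma shift_closed: "e \<in> arcs H \<Longrightarrow> shift \<chi> e \<in> carrier (P (head (gr \<L>) e))"
  using choice by (simp add: is_collapse_choice_def Let_def head_H)

lemma shift_arev: "e \<in> arcs H \<Longrightarrow>
    shift \<chi> (arev \<L> e) \<otimes>\<^bsub>P (head (gr \<L>) e)\<^esub> inv\<^bsub>P (head (gr \<L>) e)\<^esub> (shift \<chi> e) = ecls e"
  using choice by (simp add: is_collapse_choice_def Let_def head_H tail_H ecls_def)

lemma vcls_closed:
  "v \<in> verts (gr \<L>) \<Longrightarrow> g \<in> carrier (vgrp \<L> v) \<Longrightarrow> vcls v g \<in> carrier (P v)"
  using vcls_mon[of v] by (auto simp: mon_def hom_def)

abbreviation "\<L>1 \<equiv> collapse \<L> H \<chi>"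

lemma \<L>1_sel:
  "verts (gr \<L>1) = H.sccs_verts" "arcs (gr \<L>1) = arcs (gr \<L>) - arcs H"
  "tail (gr \<L>1) e = scc (tail (gr \<L>) e)" "head (gr \<L>1) e = scc (head (gr \<L>) e)"
  "arev \<L>1 = perm_restrict (arev \<L>) (arcs (gr \<L>) - arcs H)"
  "vgrp \<L>1 C = pi1 (K C) (base \<chi> C)" "egrp \<L>1 = egrp \<L>"
  "inc \<L>1 e h = vcls (head (gr \<L>) e) (inc \<L> e h)"
  by (simp_all add: collapse_def Let_def)

text \<open>A walk in the original graph descends to the quotient: its edges in \<open>H\<close>
  become stationary and the others survive.\<close>

lemma connected_collapse: "connected (gr \<L>1)"
proof -
  interpret W: wf_digraph "gr \<L>1"
    by unfold_locales (auto simp: \<L>1_sel intro: scc_in)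
  have reach: "scc u \<rightarrow>\<^sup>*\<^bsub>gr \<L>1\<^esub> scc v" if "u \<rightarrow>\<^sup>*\<^bsub>gr \<L>\<^esub> v" for u v
    using that
  proof (induction rule: converse_reachable_induct)
    case base
    then show ?case by (simp add: \<L>1_sel scc_in)
  next
    case (step x y)
    from step(1) obtain e where e: "e \<in> arcs (gr \<L>)" "tail (gr \<L>) e = x" "head (gr \<L>) e = y" by blast
    show ?case
    proof (cases "e \<in> arcs H")
      case True
      then show ?thesis using scc_tail e step by metis
    next
      case False
      then have "scc x \<rightarrow>\<^bsub>gr \<L>1\<^esub> scc y"
        using e by (auto simp: arcs_ends_conv \<L>1_sel image_iff)
      then show ?thesis using step by (blast intro: W.adj_reachable_trans)
    qed
  qed
  show ?thesis
  proof (rule W.connectedI)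
    show "verts (gr \<L>1) \<noteq> {}"
      using strongly_connected scc_in by (auto simp: \<L>1_sel strongly_connected_def)
    fix C D assume "C \<in> verts (gr \<L>1)" "D \<in> verts (gr \<L>1)"
    then obtain u v where "C = scc u" "D = scc v" "u \<in> verts (gr \<L>)" "v \<in> verts (gr \<L>)"
      by (auto simp: \<L>1_sel H.sccs_verts_conv_scc_of verts_H)
    then have "C \<rightarrow>\<^sup>*\<^bsub>gr \<L>1\<^esub> D"
      using strongly_connected reach by (auto simp: strongly_connected_def)
    then show "C \<rightarrow>\<^sup>*\<^bsub>mk_symmetric (gr \<L>1)\<^esub> D" by (rule W.reachable_mk_symmetricI)
  qed
qed

text \<open>The substance is injectivity of the new inclusions. Each is an old inclusion followed by
  the embedding of a vertex group into the fundamental group of its component.\<close>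

lemma graph_of_groups_collapse: "graph_of_groups \<L>1"
proof (intro graph_of_groups.intro graph_of_groups_axioms.intro connected_collapse)
  interpret W: wf_digraph "gr \<L>1"
    by unfold_locales (auto simp: \<L>1_sel intro: scc_in)
  show "bidirected_digraph (gr \<L>1) (arev \<L>1)"
    by (rule W.bidirected_digraphI)
      (auto simp: \<L>1_sel perm_restrict_def arev_H_iff dest: arev_neq split: if_splits)
  show "group (vgrp \<L>1 C)" if "C \<in> verts (gr \<L>1)" for C
    using that base_in by (auto simp: \<L>1_sel intro!: graph_of_groups.group_pi1 graph_of_groups_K)
  show "group (egrp \<L>1 e)" "egrp \<L>1 (arev \<L>1 e) = egrp \<L>1 e"
    "inc \<L>1 e \<in> mon (egrp \<L>1 e) (vgrp \<L>1 (head (gr \<L>1) e))" if "e \<in> arcs (gr \<L>1)" for e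
  proof -
    have e: "e \<in> arcs (gr \<L>)" using that by (simp add: \<L>1_sel)
    show "group (egrp \<L>1 e)" using egrp_group[OF e] by (simp add: \<L>1_sel)
    show "egrp \<L>1 (arev \<L>1 e) = egrp \<L>1 e"
      using egrp_arev[OF e] that by (simp add: \<L>1_sel perm_restrict_def)
    have "(\<lambda>h. vcls (head (gr \<L>) e) (inc \<L> e h)) \<in> mon (egrp \<L> e) (P (head (gr \<L>) e))"
      using mon_compose[OF inc_mon[OF e] vcls_mon] e by (simp add: o_def)
    then show "inc \<L>1 e \<in> mon (egrp \<L>1 e) (vgrp \<L>1 (head (gr \<L>1) e))"
      by (simp add: \<L>1_sel[abs_def])
  qed
qed

lemma collapse_map_sel:
  "vmap (collapse_map \<L> H \<chi>) = scc"
  "emap (collapse_map \<L> H \<chi>) e = (if e \<in> arcs H then Inr (scc (head (gr \<L>) e)) else Inl e)"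
  "vhom (collapse_map \<L> H \<chi>) v = vcls v"
  "ehom (collapse_map \<L> H \<chi>) e h = h"
  "chom (collapse_map \<L> H \<chi>) e h = inv\<^bsub>P (head (gr \<L>) e)\<^esub> (shift \<chi> e)
    \<otimes>\<^bsub>P (head (gr \<L>) e)\<^esub> vcls (head (gr \<L>) e) (inc \<L> e h) \<otimes>\<^bsub>P (head (gr \<L>) e)\<^esub> shift \<chi> e"
  "delta (collapse_map \<L> H \<chi>) e =
    (if e \<in> arcs H then shift \<chi> e else \<one>\<^bsub>P (head (gr \<L>) e)\<^esub>)"
  by (auto simp: collapse_map_def Let_def head_H \<L>1_sel)

text \<open>On a collapsed edge \<open>chom\<close> was defined by solving the morphism equation at
  the head, so that equation is automatic there. What remains is that the two orientations give the
  same \<open>chom\<close>, and this is where the condition on shifts enters.\<close>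

lemma collapse_morphism: "gog_morphism \<L> \<L>1 (collapse_map \<L> H \<chi>)"
  unfolding gog_morphism_def
proof (intro conjI ballI, goal_cases)
  case (1 v)
  then show ?case by (simp add: collapse_map_sel \<L>1_sel scc_in)
next
  case (2 v)
  then show ?case using vcls_mon[of v] by (simp add: collapse_map_sel[abs_def] \<L>1_sel mon_def)
next
  case (3 e)
  note e = 3
  let ?c = "collapse_map \<L> H \<chi>"
  let ?w = "tail (gr \<L>) e" and ?x = "head (gr \<L>) e"
  have w: "?w \<in> verts (gr \<L>)" and x: "?x \<in> verts (gr \<L>)" using e by auto
  interpret Px: group "P ?x" by (rule group_P[OF x])
  have vx: "vcls ?x (inc \<L> e h) \<in> carrier (P ?x)" if "h \<in> carrier (egrp \<L> e)" for h
    using vcls_closed[OF x inc_closed[OF e that]] .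
  show ?case
  proof (cases "e \<in> arcs H")
    case True
    have r: "arev \<L> e \<in> arcs H" using arev_H[OF True] .
    have Pw: "scc ?w = scc ?x" using scc_tail[OF True] .
    note s = shift_closed[OF True]
    have s': "shift \<chi> (arev \<L> e) \<in> carrier (P ?x)" using shift_closed[OF r] e Pw by simp
    have vh: "(\<lambda>h. vcls ?x (inc \<L> e h)) \<in> hom (egrp \<L> e) (P ?x)"
      using mon_compose[OF inc_mon[OF e] vcls_mon[OF x]] by (simp add: o_def mon_def)
    have hom: "chom ?c e \<in> hom (egrp \<L> e) (P ?x)"
      using Px.conj_hom[OF vh s] by (simp add: collapse_map_sel[abs_def])
    have sym: "chom ?c (arev \<L> e) h = chom ?c e h" if h: "h \<in> carrier (egrp \<L> e)" for h
    proof -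
      have "vcls ?w (inc \<L> (arev \<L> e) h) \<in> carrier (P ?x)"
        using vcls_closed[OF w inc_arev_closed[OF e h]] by (simp add: Pw)
      \<comment> \<open>The quotient of the two shifts is \<open>ecls e\<close>, so the premise left
        over is \<open>ecls_slide\<close>.\<close>
      from Px.conj_eq[OF s s' this vx[OF h]] show ?thesis
        using ecls_slide[OF True h] e by (simp add: shift_arev[OF True] collapse_map_sel Pw)
    qed
    have "vcls ?x (inc \<L> e h) = shift \<chi> e \<otimes>\<^bsub>P ?x\<^esub> chom ?c e h \<otimes>\<^bsub>P ?x\<^esub> inv\<^bsub>P ?x\<^esub> (shift \<chi> e)"
      if "h \<in> carrier (egrp \<L> e)" for h
      using s vx[OF that] by (simp add: collapse_map_sel Px.m_assoc Px.inv_mult_cancel)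
    then show ?thesis
      using True r s hom sym e Pw by (simp add: collapse_map_sel(1-3,6) \<L>1_sel)
  next
    case False
    then have r: "arev \<L> e \<notin> arcs H" by (simp add: arev_H_iff)
    have "ehom ?c e \<in> hom (egrp \<L> e) (egrp \<L> e)"
      by (rule homI) (simp_all add: collapse_map_sel group.is_monoid monoid.m_closed egrp_group e)
    then show ?thesis
      using False r vx e by (simp add: collapse_map_sel \<L>1_sel perm_restrict_def)
  qed
qed

end

section \<open>Collapsing a morphism onto its image\<close>

locale gog_mor = graph_of_groups \<L> + G: graph_of_groups \<G>
  for \<L> :: "('v, 'e, 'g, 'h) gog" and \<G> :: "('w, 'd, 'k, 'l) gog" +
  fixes f :: "('v, 'e, 'g, 'h, 'w, 'd, 'k, 'l) gog_map"
  assumes mor: "gog_morphism \<L> \<G> f"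
begin

lemma vmap_closed: "v \<in> verts (gr \<L>) \<Longrightarrow> vmap f v \<in> verts (gr \<G>)"
  and vhom_hom: "v \<in> verts (gr \<L>) \<Longrightarrow> vhom f v \<in> hom (vgrp \<L> v) (vgrp \<G> (vmap f v))"
  using mor by (auto simp: gog_morphism_def)

lemma group_target: "v \<in> verts (gr \<L>) \<Longrightarrow> group (vgrp \<G> (vmap f v))"
  using vmap_closed G.vgrp_group by blast

lemma vhom_closed:
  "v \<in> verts (gr \<L>) \<Longrightarrow> g \<in> carrier (vgrp \<L> v) \<Longrightarrow> vhom f v g \<in> carrier (vgrp \<G> (vmap f v))"
  using vhom_hom by (rule hom_in_carrier)

lemma vhom_one: "v \<in> verts (gr \<L>) \<Longrightarrow> vhom f v \<one>\<^bsub>vgrp \<L> v\<^esub> = \<one>\<^bsub>vgrp \<G> (vmap f v)\<^esub>"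
  using vhom_hom vgrp_group group_target by (rule hom_one)

lemmas mor_edge = bspec[OF conjunct2[OF mor[unfolded gog_morphism_def]], unfolded Let_def]

lemma delta_closed: "e \<in> arcs (gr \<L>) \<Longrightarrow> delta f e \<in> carrier (vgrp \<G> (vmap f (head (gr \<L>) e)))"
  using mor_edge by blast

lemma emap_Inl:
  assumes e: "e \<in> arcs (gr \<L>)" "emap f e = Inl e'"
  shows emap_arc: "e' \<in> arcs (gr \<G>)"
    and head_emap: "head (gr \<G>) e' = vmap f (head (gr \<L>) e)"
    and emap_arev: "emap f (arev \<L> e) = Inl (arev \<G> e')"
    and ehom_hom: "ehom f e \<in> hom (egrp \<L> e) (egrp \<G> e')"
    and ehom_arev: "h \<in> carrier (egrp \<L> e) \<Longrightarrow> ehom f (arev \<L> e) h = ehom f e h"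
    and vhom_inc: "h \<in> carrier (egrp \<L> e) \<Longrightarrow> vhom f (head (gr \<L>) e) (inc \<L> e h) =
      delta f e \<otimes>\<^bsub>vgrp \<G> (vmap f (head (gr \<L>) e))\<^esub> inc \<G> e' (ehom f e h)
        \<otimes>\<^bsub>vgrp \<G> (vmap f (head (gr \<L>) e))\<^esub> inv\<^bsub>vgrp \<G> (vmap f (head (gr \<L>) e))\<^esub> (delta f e)"
  using mor_edge[OF e(1)] unfolding e(2) by simp_all

lemma emap_Inr:
  assumes e: "e \<in> arcs (gr \<L>)" "emap f e = Inr w"
  shows vmap_head: "vmap f (head (gr \<L>) e) = w"
    and vmap_tail: "vmap f (tail (gr \<L>) e) = w"
    and emap_arev_Inr: "emap f (arev \<L> e) = Inr w"
    and chom_hom: "chom f e \<in> hom (egrp \<L> e) (vgrp \<G> w)"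
    and chom_arev: "h \<in> carrier (egrp \<L> e) \<Longrightarrow> chom f (arev \<L> e) h = chom f e h"
    and vhom_inc_Inr: "h \<in> carrier (egrp \<L> e) \<Longrightarrow> vhom f (head (gr \<L>) e) (inc \<L> e h) =
      delta f e \<otimes>\<^bsub>vgrp \<G> w\<^esub> chom f e h \<otimes>\<^bsub>vgrp \<G> w\<^esub> inv\<^bsub>vgrp \<G> w\<^esub> (delta f e)"
proof -
  have *: "w' = vmap f (head (gr \<L>) a) \<and> emap f (arev \<L> a) = Inr w' \<and>
      chom f a \<in> hom (egrp \<L> a) (vgrp \<G> w') \<and>
      (\<forall>h\<in>carrier (egrp \<L> a). chom f (arev \<L> a) h = chom f a h \<and>
        vhom f (head (gr \<L>) a) (inc \<L> a h) =
        delta f a \<otimes>\<^bsub>vgrp \<G> w'\<^esub> chom f a h \<otimes>\<^bsub>vgrp \<G> w'\<^esub> inv\<^bsub>vgrp \<G> w'\<^esub> (delta f a))"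
    if "a \<in> arcs (gr \<L>)" "emap f a = Inr w'" for a w'
    using mor_edge[OF that(1)] unfolding that(2) by auto
  from *[OF e] show "vmap f (head (gr \<L>) e) = w" "emap f (arev \<L> e) = Inr w"
    "chom f e \<in> hom (egrp \<L> e) (vgrp \<G> w)"
    "h \<in> carrier (egrp \<L> e) \<Longrightarrow> chom f (arev \<L> e) h = chom f e h"
    "h \<in> carrier (egrp \<L> e) \<Longrightarrow> vhom f (head (gr \<L>) e) (inc \<L> e h) =
      delta f e \<otimes>\<^bsub>vgrp \<G> w\<^esub> chom f e h \<otimes>\<^bsub>vgrp \<G> w\<^esub> inv\<^bsub>vgrp \<G> w\<^esub> (delta f e)"
    by auto
  \<comment> \<open>The tail is the head of the reversed edge, which is collapsed to the same
    vertex.\<close>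
  then show "vmap f (tail (gr \<L>) e) = w"
    using *[of "arev \<L> e" w] e by simp
qed

end

locale noncollapsing_mor = gog_mor +
  assumes no_edge: "collapses_no_edge \<L> f"
begin

lemma emapE:
  assumes "e \<in> arcs (gr \<L>)"
  obtains e' where "emap f e = Inl e'"
  using assms no_edge by (auto simp: collapses_no_edge_def isl_def)

abbreviation "\<I> \<equiv> image_gog \<L> \<G> f"

lemma \<I>_sel: "gr \<I> = gr \<L>" "arev \<I> = arev \<L>"
  "vgrp \<I> v = (vgrp \<G> (vmap f v))\<lparr>carrier := vhom f v ` carrier (vgrp \<L> v)\<rparr>"
  "egrp \<I> e = (egrp \<G> (projl (emap f e)))\<lparr>carrier := ehom f e ` carrier (egrp \<L> e)\<rparr>"
  by (simp_all add: image_gog_def)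

lemma inc_\<I>: "inc \<I> e h = delta f e \<otimes>\<^bsub>vgrp \<G> (vmap f (head (gr \<L>) e))\<^esub> inc \<G> (projl (emap f e)) h
    \<otimes>\<^bsub>vgrp \<G> (vmap f (head (gr \<L>) e))\<^esub> inv\<^bsub>vgrp \<G> (vmap f (head (gr \<L>) e))\<^esub> (delta f e)"
  by (simp add: image_gog_def Let_def)

lemma image_subgroup:
  assumes "group A" "group B" "k \<in> hom A B"
  shows "group (B\<lparr>carrier := k ` carrier A\<rparr>)"
  using assms group_hom.img_is_subgroup[of A B k] subgroup.subgroup_is_group
  by (simp add: group_hom_def group_hom_axioms_def)

text \<open>The twisted inclusion stays inside the image vertex group because, on the image of h,
  the morphism equation identifies it with the image of the old inclusion of h. Its injectivity
  comes from the target, whose inclusion is merely conjugated.\<close>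

lemma graph_of_groups_image: "graph_of_groups \<I>"
proof (intro graph_of_groups.intro graph_of_groups_axioms.intro)
  show "bidirected_digraph (gr \<I>) (arev \<I>)" "Digraph_Component.connected (gr \<I>)"
    using bidirected_digraph connected by (simp_all add: \<I>_sel)
  show "group (vgrp \<I> v)" if "v \<in> verts (gr \<I>)" for v
    using that by (simp add: \<I>_sel image_subgroup vhom_hom group_target vgrp_group)
  fix e assume "e \<in> arcs (gr \<I>)"
  then have e: "e \<in> arcs (gr \<L>)" by (simp add: \<I>_sel)
  obtain e' where e': "emap f e = Inl e'" using e by (rule emapE)
  note E = emap_Inl[OF e e']
  let ?x = "head (gr \<L>) e"
  have x: "?x \<in> verts (gr \<L>)" using e by simp
  show "group (egrp \<I> e)"
    using e e' by (simp add: \<I>_sel image_subgroup E(4) egrp_group G.egrp_group[OF E(1)])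
  show "egrp \<I> (arev \<I> e) = egrp \<I> e"
    using E e' by (simp add: \<I>_sel egrp_arev[OF e] G.egrp_arev)
  show "inc \<I> e \<in> mon (egrp \<I> e) (vgrp \<I> (head (gr \<I>) e))"
  proof -
    interpret V: group "vgrp \<G> (vmap f ?x)" by (rule group_target[OF x])
    note d = delta_closed[OF e]
    have ec: "ehom f e h \<in> carrier (egrp \<G> e')" if "h \<in> carrier (egrp \<L> e)" for h
      using hom_in_carrier[OF E(4) that] .
    have ic: "inc \<G> e' h \<in> carrier (vgrp \<G> (vmap f ?x))" if "h \<in> carrier (egrp \<G> e')" for h
      using G.inc_closed[OF E(1) that] by (simp add: E(2))
    have im: "inc \<G> e' (h \<otimes>\<^bsub>egrp \<G> e'\<^esub> h') = inc \<G> e' h \<otimes>\<^bsub>vgrp \<G> (vmap f ?x)\<^esub> inc \<G> e' h'"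
      if "h \<in> carrier (egrp \<G> e')" "h' \<in> carrier (egrp \<G> e')" for h h'
      using G.inc_mon[OF E(1)] that by (simp add: E(2) mon_def hom_def)
    have inj: "inj_on (inc \<G> e') (carrier (egrp \<G> e'))"
      using G.inc_mon[OF E(1)] by (simp add: mon_def)
    have inc_ehom: "inc \<I> e (ehom f e h) = vhom f ?x (inc \<L> e h)" if "h \<in> carrier (egrp \<L> e)" for h
      using E(6)[OF that] by (simp add: inc_\<I> e')
    have "inc \<I> e \<in> hom (egrp \<I> e) (vgrp \<I> ?x)"
    proof (rule homI)
      show "inc \<I> e y \<in> carrier (vgrp \<I> ?x)" if "y \<in> carrier (egrp \<I> e)" for y
        using that inc_ehom inc_closed[OF e] by (auto simp: \<I>_sel)
      show "inc \<I> e (y \<otimes>\<^bsub>egrp \<I> e\<^esub> y') = inc \<I> e y \<otimes>\<^bsub>vgrp \<I> ?x\<^esub> inc \<I> e y'"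
        if "y \<in> carrier (egrp \<I> e)" "y' \<in> carrier (egrp \<I> e)" for y y'
        using that d by (auto simp: \<I>_sel inc_\<I> e' ec ic im V.m_assoc V.inv_mult_cancel)
    qed
    moreover have "inj_on (inc \<I> e) (carrier (egrp \<I> e))"
    proof (rule inj_onI)
      fix y y' assume y: "y \<in> carrier (egrp \<I> e)" "y' \<in> carrier (egrp \<I> e)"
        and eq: "inc \<I> e y = inc \<I> e y'"
      have yc: "y \<in> carrier (egrp \<G> e')" "y' \<in> carrier (egrp \<G> e')"
        using y ec by (auto simp: \<I>_sel)
      have "inc \<G> e' y = inc \<G> e' y'" using eq d ic[OF yc(1)] ic[OF yc(2)] by (simp add: inc_\<I> e')
      then show "y = y'" using inj yc by (auto dest: inj_onD)
    qed
    ultimately show ?thesis by (simp add: mon_def \<I>_sel(1))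
  qed
qed

lemma onto_image_morphism: "gog_morphism \<L> \<I> (onto_image \<L> \<G> f)"
  unfolding gog_morphism_def
proof (intro conjI ballI, goal_cases)
  case (1 v)
  then show ?case by (simp add: onto_image_def \<I>_sel)
next
  case (2 v)
  then show ?case using vhom_hom[of v] by (auto simp: onto_image_def \<I>_sel hom_def)
next
  case (3 e)
  note e = 3
  obtain e' where e': "emap f e = Inl e'" using e by (rule emapE)
  note E = emap_Inl[OF e e']
  let ?x = "head (gr \<L>) e"
  let ?V = "vgrp \<G> (vmap f ?x)"
  have x: "?x \<in> verts (gr \<L>)" using e by simp
  interpret V: group ?V by (rule group_target[OF x])
  \<comment> \<open>The morphism equation uses the operations of the image group, so its unit has to
    be known to lie in the smaller carrier and to be its own inverse there.\<close>
  interpret V2: group "?V\<lparr>carrier := vhom f ?x ` carrier (vgrp \<L> ?x)\<rparr>"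
    by (rule image_subgroup[OF vgrp_group[OF x] group_target[OF x] vhom_hom[OF x]])
  have one: "\<one>\<^bsub>?V\<^esub> \<in> vhom f ?x ` carrier (vgrp \<L> ?x)" using V2.one_closed by simp
  have inv1: "inv\<^bsub>?V\<lparr>carrier := vhom f ?x ` carrier (vgrp \<L> ?x)\<rparr>\<^esub> \<one>\<^bsub>?V\<^esub> = \<one>\<^bsub>?V\<^esub>"
    using V2.inv_one by simp
  have "ehom f e \<in> hom (egrp \<L> e) (egrp \<I> e)"
    using E(4) by (auto simp: \<I>_sel e' hom_def)
  moreover have "vhom f ?x (inc \<L> e h) = inc \<I> e (ehom f e h)" "vhom f ?x (inc \<L> e h) \<in> carrier ?V"
    if "h \<in> carrier (egrp \<L> e)" for h
    using E(6)[OF that] vhom_closed[OF x inc_closed[OF e that]] by (simp_all add: inc_\<I> e')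
  ultimately show ?case
    using e one inv1 E(5) by (simp add: onto_image_def \<I>_sel(1-3))
qed

text \<open>All local maps are inclusions of subsets, and the morphism equation is the definition of
  the inclusions of the image structure.\<close>

lemma image_inclusion_stallings: "stallings \<I> \<G> (image_inclusion f)"
proof -
  have vmon: "vhom (image_inclusion f) v \<in> mon (vgrp \<I> v) (vgrp \<G> (vmap (image_inclusion f) v))"
    if "v \<in> verts (gr \<L>)" for v
    using vhom_closed[OF that] by (auto simp: image_inclusion_def \<I>_sel mon_def hom_def inj_on_def)
  have emon: "ehom (image_inclusion f) e \<in> mon (egrp \<I> e) (egrp \<G> e')"
    if "e \<in> arcs (gr \<L>)" "emap f e = Inl e'" for e e'
    using hom_in_carrier[OF ehom_hom[OF that]] that(2)
    by (auto simp: image_inclusion_def \<I>_sel mon_def hom_def inj_on_def)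
  have "gog_morphism \<I> \<G> (image_inclusion f)"
    unfolding gog_morphism_def
  proof (intro conjI ballI, goal_cases)
    case (1 v)
    then show ?case using vmap_closed by (simp add: image_inclusion_def \<I>_sel(1))
  next
    case (2 v)
    then show ?case using vmon by (simp add: mon_def \<I>_sel(1))
  next
    case (3 e)
    then have e: "e \<in> arcs (gr \<L>)" by (simp add: \<I>_sel)
    obtain e' where e': "emap f e = Inl e'" using e by (rule emapE)
    have s: "vmap (image_inclusion f) = vmap f" "emap (image_inclusion f) = emap f"
      "vhom (image_inclusion f) = (\<lambda>v g. g)" "delta (image_inclusion f) = delta f"
      "ehom (image_inclusion f) = (\<lambda>e h. h)"
      by (simp_all add: image_inclusion_def)
    have "ehom (image_inclusion f) e \<in> hom (egrp \<I> e) (egrp \<G> e')"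
      using emon[OF e e'] by (simp add: mon_def)
    then show ?case
      using emap_Inl(1-3)[OF e e'] delta_closed[OF e] e'
      by (simp add: s \<I>_sel(1,2) inc_\<I>)
  qed
  moreover have "collapses_no_edge \<I> (image_inclusion f)"
    using no_edge by (simp add: collapses_no_edge_def image_inclusion_def \<I>_sel)
  moreover have "ehom (image_inclusion f) e \<in> mon (egrp \<I> e) (egrp \<G> (projl (emap (image_inclusion f) e)))"
    if "e \<in> arcs (gr \<L>)" for e
    using emapE[OF that] emon[OF that] by (metis image_inclusion_def gog_map.select_convs(2) sum.sel(1))
  ultimately show ?thesis using vmon by (simp add: stallings_def \<I>_sel(1))
qed

lemma image_factorization:
  "same_morphism \<L> f (gog_comp \<L> \<G> (image_inclusion f) (onto_image \<L> \<G> f))"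
  unfolding same_morphism_def
proof (intro conjI ballI)
  fix e assume e: "e \<in> arcs (gr \<L>)"
  obtain e' where e': "emap f e = Inl e'" using e by (rule emapE)
  show "emap (gog_comp \<L> \<G> (image_inclusion f) (onto_image \<L> \<G> f)) e = emap f e"
    by (simp add: gog_comp_def onto_image_def image_inclusion_def)
  show "delta (gog_comp \<L> \<G> (image_inclusion f) (onto_image \<L> \<G> f)) e = delta f e"
    using group_target[of "head (gr \<L>) e"] delta_closed[OF e] e
    by (simp add: gog_comp_def onto_image_def image_inclusion_def Let_def group.is_monoid monoid.l_one)
  show "if isl (emap f e) then ehom (gog_comp \<L> \<G> (image_inclusion f) (onto_image \<L> \<G> f)) e h = ehom f e h
      else chom (gog_comp \<L> \<G> (image_inclusion f) (onto_image \<L> \<G> f)) e h = chom f e h"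
    if "h \<in> carrier (egrp \<L> e)" for h
    using e' by (simp add: gog_comp_def onto_image_def image_inclusion_def)
qed (simp_all add: gog_comp_def onto_image_def image_inclusion_def)

end

section \<open>Collapsing the fibres of a morphism\<close>

lemma conjugate_by_same_morphism:
  assumes L: "graph_of_groups \<L>"
    and c: "conjugate_by \<L> \<G> m f f'" and s: "same_morphism \<L> f' f''"
  shows "conjugate_by \<L> \<G> m f f''"
proof -
  interpret graph_of_groups \<L> by fact
  have V: "vmap f'' v = vmap f' v" "g \<in> carrier (vgrp \<L> v) \<Longrightarrow> vhom f'' v g = vhom f' v g"
    if "v \<in> verts (gr \<L>)" for v g
    using s that by (simp_all add: same_morphism_def)
  have E: "emap f'' e = emap f' e" "delta f'' e = delta f' e"
    "h \<in> carrier (egrp \<L> e) \<Longrightarrow> isl (emap f' e) \<Longrightarrow> ehom f'' e h = ehom f' e h"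
    "h \<in> carrier (egrp \<L> e) \<Longrightarrow> \<not> isl (emap f' e) \<Longrightarrow> chom f'' e h = chom f' e h"
    if "e \<in> arcs (gr \<L>)" for e h
    using s that by (auto simp: same_morphism_def)
  show ?thesis
    unfolding conjugate_by_def
  proof (intro conjI ballI, goal_cases)
    case (1 v)
    note v = 1
    show ?case
      using bspec[OF conjunct1[OF c[unfolded conjugate_by_def]] v] V[OF v] by (simp add: Let_def)
  next
    case (2 e)
    note e = 2
    then have r: "arev \<L> e \<in> arcs (gr \<L>)" by simp
    show ?case
      using bspec[OF conjunct2[OF c[unfolded conjugate_by_def]] e] E[OF e] E(2)[OF r]
      by (cases "emap f e") (simp_all add: Let_def)
  qed
qed

section \<open>The fibres and the values of their paths\<close>

context gog_mor
begin

lemma fibres_sel: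
  "verts (fibres \<L> \<G> f) = verts (gr \<L>)"
  "arcs (fibres \<L> \<G> f) = {e \<in> arcs (gr \<L>). \<not> isl (emap f e)}"
  "tail (fibres \<L> \<G> f) = tail (gr \<L>)" "head (fibres \<L> \<G> f) = head (gr \<L>)"
proof -
  \<comment> \<open>A collapsed edge lies in the fibre over the image of its head, a vertex of the
    target, so the union of the fibres over the vertices contains every collapsed edge.\<close>
  have "vmap f (head (gr \<L>) e) = w \<and> w \<in> verts (gr \<G>)" if "e \<in> arcs (gr \<L>)" "emap f e = Inr w" for e w
    using vmap_head[OF that] vmap_closed[of "head (gr \<L>) e"] that by auto
  then show "arcs (fibres \<L> \<G> f) = {e \<in> arcs (gr \<L>). \<not> isl (emap f e)}"
    by (auto simp: fibres_def pre_digraph.Union_def fibre_def isl_def split: sum.splits)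
      (metis sum.exhaust)
qed (auto simp: fibres_def pre_digraph.Union_def fibre_def vmap_closed)

lemma arcs_fibresE:
  assumes "e \<in> arcs (fibres \<L> \<G> f)"
  obtains w where "e \<in> arcs (gr \<L>)" "emap f e = Inr w"
  using assms by (cases "emap f e") (auto simp: fibres_sel)

sublocale spanning_subgraph \<L> "fibres \<L> \<G> f"
proof
  show "arev \<L> e \<in> arcs (fibres \<L> \<G> f)" if "e \<in> arcs (fibres \<L> \<G> f)" for e
    using that by (rule arcs_fibresE) (auto simp: fibres_sel emap_arev_Inr)
qed (auto simp: fibres_sel)

lemma vmap_reachable:
  assumes "u \<rightarrow>\<^sup>*\<^bsub>fibres \<L> \<G> f\<^esub> v"
  shows "vmap f u = vmap f v"
  using assms
proof (induction rule: H.converse_reachable_induct)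
  case (step x y)
  from step(1) obtain e where e: "e \<in> arcs (fibres \<L> \<G> f)" "tail (gr \<L>) e = x" "head (gr \<L>) e = y"
    by (auto simp: arcs_ends_conv fibres_sel)
  from e(1) obtain w where "e \<in> arcs (gr \<L>)" "emap f e = Inr w" by (rule arcs_fibresE)
  then show ?case using vmap_head vmap_tail e step by metis
qed simp

lemma vmap_component:
  assumes "C \<in> H.sccs_verts" "u \<in> C" "v \<in> C"
  shows "vmap f u = vmap f v"
  using assms by (intro vmap_reachable) (simp add: H.in_sccs_verts_conv_reachable)

definition tr :: "'e \<Rightarrow> 'k" where
  "tr e = (let V = vgrp \<G> (vmap f (head (gr \<L>) e)) in
    delta f (arev \<L> e) \<otimes>\<^bsub>V\<^esub> inv\<^bsub>V\<^esub> (delta f e))"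

text \<open>On a component of a fibre, f takes values in a single vertex group. The two inclusions
  of an element of a collapsed edge group are sent to conjugates of the same \<open>chom\<close>
  value by the elements \<delta> at the two orientations, and \<open>tr\<close> is the element that
  carries one conjugate to the other.\<close>

lemma fibre_rep:
  assumes C: "C \<in> H.sccs_verts" and u: "u \<in> C"
  shows "gog_rep (K C) (vgrp \<G> (vmap f u)) (vhom f) tr"
proof (intro gog_rep.intro gog_rep_axioms.intro graph_of_groups_K[OF C])
  have uv: "u \<in> verts (gr \<L>)" using scc_subset[OF C] u by blast
  show A: "group (vgrp \<G> (vmap f u))" by (rule group_target[OF uv])
  interpret A: group "vgrp \<G> (vmap f u)" by fact
  show "vhom f v \<in> hom (vgrp (K C) v) (vgrp \<G> (vmap f u))" if "v \<in> verts (gr (K C))" for v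
    using vhom_hom[of v] that vmap_component[OF C u, of v] scc_subset[OF C] by auto
  fix e assume e: "e \<in> arcs (gr (K C))"
  then have eH: "e \<in> arcs (fibres \<L> \<G> f)" by simp
  then obtain w where eL: "e \<in> arcs (gr \<L>)" and w: "emap f e = Inr w" by (rule arcs_fibresE)
  note E = emap_Inr[OF eL w]
  have wu: "w = vmap f u"
    using E(1) vmap_component[OF C u, of "head (gr \<L>) e"] e arcs_K[OF C] by simp
  have d: "delta f e \<in> carrier (vgrp \<G> (vmap f u))" using delta_closed[OF eL] E(1) wu by simp
  have d': "delta f (arev \<L> e) \<in> carrier (vgrp \<G> (vmap f u))"
    using delta_closed[of "arev \<L> e"] E(2) wu eL by simp
  have tr: "tr e = delta f (arev \<L> e) \<otimes>\<^bsub>vgrp \<G> (vmap f u)\<^esub> inv\<^bsub>vgrp \<G> (vmap f u)\<^esub> (delta f e)"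
    using E(1) wu by (simp add: tr_def Let_def)
  have tr': "tr (arev \<L> e) = delta f e \<otimes>\<^bsub>vgrp \<G> (vmap f u)\<^esub> inv\<^bsub>vgrp \<G> (vmap f u)\<^esub> (delta f (arev \<L> e))"
    using E(2) wu eL by (simp add: tr_def Let_def)
  have rK: "arev (K C) e = arev \<L> e" using e by (simp add: perm_restrict_def)
  show "tr e \<in> carrier (vgrp \<G> (vmap f u))" using d d' by (simp add: tr)
  show "tr (arev (K C) e) = inv\<^bsub>vgrp \<G> (vmap f u)\<^esub> (tr e)"
    unfolding rK using d d' by (simp add: tr tr' A.inv_mult_group)
  fix h assume "h \<in> carrier (egrp (K C) e)"
  then have h: "h \<in> carrier (egrp \<L> e)" by simp
  have ch: "chom f e h \<in> carrier (vgrp \<G> (vmap f u))" using hom_in_carrier[OF E(4) h] wu by simp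
  have "vhom f (tail (gr \<L>) e) (inc \<L> (arev \<L> e) h) =
      delta f (arev \<L> e) \<otimes>\<^bsub>vgrp \<G> (vmap f u)\<^esub> chom f e h
        \<otimes>\<^bsub>vgrp \<G> (vmap f u)\<^esub> inv\<^bsub>vgrp \<G> (vmap f u)\<^esub> (delta f (arev \<L> e))"
    using emap_Inr(6)[of "arev \<L> e" w h] E(3,5) eL h wu by (simp add: egrp_arev)
  then show "tr e \<otimes>\<^bsub>vgrp \<G> (vmap f u)\<^esub> vhom f (head (gr (K C)) e) (inc (K C) e h) =
      vhom f (tail (gr (K C)) e) (inc (K C) (arev (K C) e) h) \<otimes>\<^bsub>vgrp \<G> (vmap f u)\<^esub> tr e"
    unfolding rK using E(6)[OF h] d d' ch
    by (simp add: wu tr fibres_sel A.m_assoc A.inv_mult_cancel)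
qed

text \<open>\<open>fibre_value\<close> names the target group anew at each vertex of the path; as
  \<open>vmap f\<close> is constant on a component, any vertex w of it may name that group once and
  for all. This makes homotopy invariance available.\<close>

lemma fibre_value_eq_path_val:
  assumes C: "C \<in> H.sccs_verts" and w: "w \<in> C" and p: "is_path (K C) u p v"
  shows "fibre_value \<L> \<G> f u p =
    gog_rep.path_val (K C) (vgrp \<G> (vmap f w)) (vhom f) tr u p"
proof -
  interpret R: gog_rep "K C" "vgrp \<G> (vmap f w)" "vhom f" tr by (rule fibre_rep[OF C w])
  have "fibre_value \<L> \<G> f u (g, s) = R.path_val u (g, s)" if "is_path (K C) u (g, s) v" for g s
    using that
  proof (induction s arbitrary: u g)
    case (Cons y s)
    obtain e k where [simp]: "y = (e, k)" by (cases y)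
    from Cons.prems have e: "e \<in> arcs (gr (K C))" and u: "u = tail (gr \<L>) e" and uC: "u \<in> C"
      and g: "g \<in> carrier (vgrp \<L> u)" and s: "is_path (K C) (head (gr \<L>) e) (k, s) v"
      by (auto simp: fibres_sel)
    have eL: "e \<in> arcs (gr \<L>)" and hC: "head (gr \<L>) e \<in> C" using e by (auto simp: fibres_sel)
    have vu: "vmap f u = vmap f w" "vmap f (head (gr \<L>) e) = vmap f w" "vmap f (tail (gr \<L>) e) = vmap f w"
      using vmap_component[OF C _ w] uC hC u by auto
    have gc: "vhom f u g \<in> carrier (vgrp \<G> (vmap f w))" using R.\<phi>_closed[of u g] uC g by simp
    have d: "delta f e \<in> carrier (vgrp \<G> (vmap f w))" "delta f (arev \<L> e) \<in> carrier (vgrp \<G> (vmap f w))"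
      using delta_closed[OF eL] delta_closed[of "arev \<L> e"] eL vu by simp_all
    have tr: "tr e = delta f (arev \<L> e) \<otimes>\<^bsub>vgrp \<G> (vmap f w)\<^esub> inv\<^bsub>vgrp \<G> (vmap f w)\<^esub> (delta f e)"
      using vu by (simp add: tr_def Let_def)
    show ?case
      using Cons.IH[OF s] vu gc d R.path_val_closed[OF s]
      by (simp add: Let_def tr fibres_sel R.A.m_assoc)
  qed simp
  then show ?thesis using p by (cases p) simp
qed

end

section \<open>The descended morphism and the factorization\<close>

locale fibre_collapse = gog_mor \<L> \<G> f
  for \<L> :: "('v, 'e, 'g, 'h) gog" and \<G> :: "('w, 'd, 'k, 'l) gog" and f +
  fixes \<chi> :: "('v, 'e, 'g) collapse_choice"
  assumes fibre_choice: "is_collapse_choice \<L> (fibres \<L> \<G> f) \<chi>"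
begin

sublocale collapse_data \<L> "fibres \<L> \<G> f" \<chi>
  by unfold_locales (fact fibre_choice)

abbreviation "f1 \<equiv> fibre_descent \<L> \<G> f \<chi>"
abbreviation "c \<equiv> collapse_map \<L> (fibres \<L> \<G> f) \<chi>"
abbreviation "m v \<equiv> fibre_value \<L> \<G> f (base \<chi> (scc v)) (link \<chi> v)"

lemma vmap_base: "v \<in> verts (gr \<L>) \<Longrightarrow> vmap f (base \<chi> (scc v)) = vmap f v"
  using vmap_component[OF scc_in base_in scc_self] scc_in by blast

lemma m_closed:
  assumes v: "v \<in> verts (gr \<L>)"
  shows "m v \<in> carrier (vgrp \<G> (vmap f v))"
proof -
  note C = scc_in[OF v]
  interpret R: gog_rep "K (scc v)" "vgrp \<G> (vmap f v)" "vhom f" tr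
    by (rule fibre_rep[OF C scc_self[OF v]])
  note l = link_path[OF C scc_self[OF v]]
  show ?thesis
    using R.path_val_closed[OF l] fibre_value_eq_path_val[OF C scc_self[OF v] l] by simp
qed

lemma descent_vhom_class:
  assumes C: "C \<in> H.sccs_verts" and w: "w \<in> C" and p: "is_path (K C) (base \<chi> C) p (base \<chi> C)"
  shows "vhom f1 C (loop_class (K C) (base \<chi> C) p) =
    gog_rep.path_val (K C) (vgrp \<G> (vmap f w)) (vhom f) tr (base \<chi> C) p"
proof -
  interpret R: gog_rep "K C" "vgrp \<G> (vmap f w)" "vhom f" tr by (rule fibre_rep[OF C w])
  have "fibre_value \<L> \<G> f (base \<chi> C) q = R.path_val (base \<chi> C) q"
    if "q \<in> loop_class (K C) (base \<chi> C) p" for q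
  proof -
    have "homotopic (K C) (base \<chi> C) (base \<chi> C) p q" using that by (simp add: loop_class_def)
    from R.homotopic_is_path(2)[OF this] show ?thesis by (rule fibre_value_eq_path_val[OF C w])
  qed
  then have "fibre_value \<L> \<G> f (base \<chi> C) ` loop_class (K C) (base \<chi> C) p =
      R.path_val (base \<chi> C) ` loop_class (K C) (base \<chi> C) p"
    by (rule image_cong[OF HOL.refl])
  then show ?thesis using R.path_val_class[OF p] by (simp add: fibre_descent_def)
qed

lemma descent_vhom_hom:
  assumes C: "C \<in> H.sccs_verts" and w: "w \<in> C"
  shows "vhom f1 C \<in> hom (pi1 (K C) (base \<chi> C)) (vgrp \<G> (vmap f w))"
proof -
  interpret R: gog_rep "K C" "vgrp \<G> (vmap f w)" "vhom f" tr by (rule fibre_rep[OF C w])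
  have "vhom f1 C X = the_elem (R.path_val (base \<chi> C) ` X)" if "X \<in> carrier (pi1 (K C) (base \<chi> C))" for X
    using that descent_vhom_class[OF C w] R.path_val_class
    by (auto simp: R.pi1_carrier simp del: K_sel)
  then show ?thesis
    using R.path_val_pi1_hom graph_of_groups.group_pi1[OF graph_of_groups_K[OF C]] base_in[OF C]
    by (auto simp: hom_def Pi_iff group.is_monoid monoid.m_closed)
qed

text \<open>The value of a linked class splits along link, path and reversed link. Taking a constant
  path or a single edge for p gives the formulas for vertex groups and for collapsed edges.\<close>

lemma descent_linked:
  assumes u: "u \<in> verts (gr \<L>)" and v: "v \<in> verts (gr \<L>)" and uv: "scc u = scc v"
    and p: "is_path (K (scc v)) u p v"
  shows "vhom f1 (scc v) (linked_class \<L> (fibres \<L> \<G> f) \<chi> u p v) =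
    m u \<otimes>\<^bsub>vgrp \<G> (vmap f v)\<^esub> fibre_value \<L> \<G> f u p \<otimes>\<^bsub>vgrp \<G> (vmap f v)\<^esub>
      inv\<^bsub>vgrp \<G> (vmap f v)\<^esub> (m v)"
proof -
  note C = scc_in[OF v] and w = scc_self[OF v]
  interpret R: gog_rep "K (scc v)" "vgrp \<G> (vmap f v)" "vhom f" tr by (rule fibre_rep[OF C w])
  interpret B: based_gog "K (scc v)" "base \<chi> (scc v)" "link \<chi>" by (rule based_gog_K[OF C])
  have lu: "is_path (K (scc v)) (base \<chi> (scc v)) (link \<chi> u) u"
    using link_path[OF C] scc_self[OF u] uv by simp
  note lv = link_path[OF C w]
  note rv = R.is_path_rev[OF lv]
  have "vhom f1 (scc v) (linked_class \<L> (fibres \<L> \<G> f) \<chi> u p v) =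
      R.path_val (base \<chi> (scc v)) (path_cat (K (scc v)) (base \<chi> (scc v)) (link \<chi> u)
        (path_cat (K (scc v)) u p (path_rev (K (scc v)) (base \<chi> (scc v)) (link \<chi> v))))"
    unfolding linked_class_eq_cls[OF u] uv B.cls_def
    by (rule descent_vhom_class[OF C w B.is_path_linked[OF p]])
  also have "\<dots> = m u \<otimes>\<^bsub>vgrp \<G> (vmap f v)\<^esub> (fibre_value \<L> \<G> f u p \<otimes>\<^bsub>vgrp \<G> (vmap f v)\<^esub>
      inv\<^bsub>vgrp \<G> (vmap f v)\<^esub> (m v))"
    unfolding R.path_val_cat[OF lu R.is_path_cat[OF p rv]] R.path_val_cat[OF p rv]
      R.path_val_rev[OF lv] uv fibre_value_eq_path_val[OF C w lu]
      fibre_value_eq_path_val[OF C w lv] fibre_value_eq_path_val[OF C w p] ..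
  finally show ?thesis
    using R.path_val_closed[OF lu] R.path_val_closed[OF lv] R.path_val_closed[OF p]
    by (simp add: R.A.m_assoc uv fibre_value_eq_path_val[OF C w lu]
        fibre_value_eq_path_val[OF C w lv] fibre_value_eq_path_val[OF C w p])
qed

lemma descent_vcls:
  assumes v: "v \<in> verts (gr \<L>)" and g: "g \<in> carrier (vgrp \<L> v)"
  shows "vhom f1 (scc v) (vcls v g) =
    m v \<otimes>\<^bsub>vgrp \<G> (vmap f v)\<^esub> vhom f v g \<otimes>\<^bsub>vgrp \<G> (vmap f v)\<^esub> inv\<^bsub>vgrp \<G> (vmap f v)\<^esub> (m v)"
  using descent_linked[OF v v HOL.refl, of "(g, [])"] g scc_self[OF v] by simp

lemma descent_ecls:
  assumes e: "e \<in> arcs (fibres \<L> \<G> f)"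
  defines "V \<equiv> vgrp \<G> (vmap f (head (gr \<L>) e))"
  shows "vhom f1 (scc (head (gr \<L>) e)) (ecls e) =
    m (tail (gr \<L>) e) \<otimes>\<^bsub>V\<^esub> (delta f (arev \<L> e) \<otimes>\<^bsub>V\<^esub> inv\<^bsub>V\<^esub> (delta f e)) \<otimes>\<^bsub>V\<^esub>
      inv\<^bsub>V\<^esub> (m (head (gr \<L>) e))"
proof -
  let ?w = "tail (gr \<L>) e" and ?x = "head (gr \<L>) e"
  obtain y where eL: "e \<in> arcs (gr \<L>)" and y: "emap f e = Inr y" using e by (rule arcs_fibresE)
  have w: "?w \<in> verts (gr \<L>)" and x: "?x \<in> verts (gr \<L>)" using eL by auto
  have vw: "vmap f ?w = vmap f ?x" using emap_Inr(1,2)[OF eL y] by simp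
  interpret V: group V unfolding V_def by (rule group_target[OF x])
  have d: "delta f e \<in> carrier V" "delta f (arev \<L> e) \<in> carrier V"
    using delta_closed[OF eL] delta_closed[of "arev \<L> e"] eL vw by (simp_all add: V_def)
  have eK: "e \<in> arcs (gr (K (scc ?x)))" using arcs_K[OF scc_in[OF x]] e scc_self[OF x] by simp
  have "is_path (K (scc ?x)) ?w (\<one>\<^bsub>vgrp \<L> ?w\<^esub>, [(e, \<one>\<^bsub>vgrp \<L> ?x\<^esub>)]) ?x"
    using eK vgrp_one_closed w x scc_self[OF x] scc_tail[OF e] by (simp add: fibres_sel)
  from descent_linked[OF w x scc_tail[OF e] this] show ?thesis
    using d vhom_one[OF w] vhom_one[OF x] vw by (simp add: ecls_def Let_def flip: V_def)
qed

lemma descent_sel: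
  "vmap f1 C = vmap f (base \<chi> C)" "emap f1 = emap f" "ehom f1 = ehom f"
  "delta f1 e = m (head (gr \<L>) e) \<otimes>\<^bsub>vgrp \<G> (vmap f (head (gr \<L>) e))\<^esub> delta f e"
  by (simp_all add: fibre_descent_def Let_def)

lemma descent_no_edge: "collapses_no_edge \<L>1 f1"
  by (simp add: collapses_no_edge_def \<L>1_sel descent_sel fibres_sel)

text \<open>On a surviving edge the new inclusion is mapped to the old value conjugated by
  \<open>m\<close> at the head. That conjugation merges with the one by the old \<delta>, which
  explains why \<delta> of the descended morphism is the product of the two.\<close>

lemma descent_morphism: "gog_morphism \<L>1 \<G> f1"
  unfolding gog_morphism_def
proof (intro conjI ballI, goal_cases)
  case (1 C)
  then have C: "C \<in> H.sccs_verts" by (simp add: \<L>1_sel)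
  show ?case
    using base_in[OF C] scc_subset[OF C] vmap_closed by (auto simp: descent_sel)
next
  case (2 C)
  then have C: "C \<in> H.sccs_verts" by (simp add: \<L>1_sel)
  show ?case
    using descent_vhom_hom[OF C base_in[OF C]] by (simp add: descent_sel \<L>1_sel)
next
  case (3 e)
  then have e: "e \<in> arcs (gr \<L>)" and eH: "e \<notin> arcs (fibres \<L> \<G> f)" by (auto simp: \<L>1_sel)
  then obtain e' where e': "emap f e = Inl e'" by (auto simp: fibres_sel isl_def)
  note E = emap_Inl[OF e e']
  let ?x = "head (gr \<L>) e"
  let ?V = "vgrp \<G> (vmap f ?x)"
  have x: "?x \<in> verts (gr \<L>)" using e by simp
  interpret V: group ?V by (rule group_target[OF x])
  note d = delta_closed[OF e] and m = m_closed[OF x]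
  have "inc \<G> e' (ehom f e h) \<in> carrier ?V" if "h \<in> carrier (egrp \<L> e)" for h
    using G.inc_closed[OF E(1) hom_in_carrier[OF E(4) that]] by (simp add: E(2))
  then have "vhom f1 (scc ?x) (vcls ?x (inc \<L> e h)) =
      delta f1 e \<otimes>\<^bsub>?V\<^esub> inc \<G> e' (ehom f e h) \<otimes>\<^bsub>?V\<^esub> inv\<^bsub>?V\<^esub> (delta f1 e)"
    if "h \<in> carrier (egrp \<L> e)" for h
    using descent_vcls[OF x inc_closed[OF e that]] E(6)[OF that] d m that
    by (simp add: descent_sel V.inv_mult_group V.m_assoc)
  moreover have "delta f1 e \<in> carrier ?V" using d m by (simp add: descent_sel)
  ultimately show ?case
    using E e eH e' vmap_base[OF x]
    by (simp add: \<L>1_sel descent_sel(1-3) perm_restrict_def)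
qed

lemma comp_sel:
  "vmap (gog_comp \<L> \<G> f1 c) v = vmap f (base \<chi> (scc v))"
  "vhom (gog_comp \<L> \<G> f1 c) v g = vhom f1 (scc v) (vcls v g)"
  "emap (gog_comp \<L> \<G> f1 c) e = (if e \<in> arcs (fibres \<L> \<G> f)
    then Inr (vmap f (base \<chi> (scc (head (gr \<L>) e)))) else emap f e)"
  by (simp_all add: gog_comp_def collapse_map_sel descent_sel)

lemma conjugate_by_collapse: "conjugate_by \<L> \<G> m f (gog_comp \<L> \<G> f1 c)"
  unfolding conjugate_by_def
proof (intro conjI ballI, goal_cases)
  case (1 v)
  note v = 1
  show ?case
    using m_closed[OF v] descent_vcls[OF v] vmap_base[OF v] by (simp add: comp_sel Let_def)
next
  case (2 e)
  note e = 2
  let ?w = "tail (gr \<L>) e" and ?x = "head (gr \<L>) e"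
  let ?V = "vgrp \<G> (vmap f ?x)"
  have w: "?w \<in> verts (gr \<L>)" and x: "?x \<in> verts (gr \<L>)" using e by auto
  interpret V: group ?V by (rule group_target[OF x])
  interpret Px: group "P ?x" by (rule group_P[OF x])
  have F: "group_hom (P ?x) ?V (vhom f1 (scc ?x))"
    using descent_vhom_hom[OF scc_in[OF x] scc_self[OF x]]
    by (intro group_hom.intro group_hom_axioms.intro Px.is_group V.is_group)
  interpret F: group_hom "P ?x" ?V "vhom f1 (scc ?x)" by (rule F)
  note d = delta_closed[OF e] and m = m_closed[OF x]
  show ?case
  proof (cases "emap f e")
    case (Inl e')
    then have "e \<notin> arcs (fibres \<L> \<G> f)" by (simp add: fibres_sel)
    then show ?thesis
      using Inl d m vmap_base[OF x]
      by (simp add: gog_comp_def collapse_map_sel descent_sel Let_def)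
  next
    case (Inr y)
    have eH: "e \<in> arcs (fibres \<L> \<G> f)" using e Inr by (simp add: fibres_sel)
    note r = arev_H[OF eH] and E = emap_Inr[OF e Inr]
    have vw: "vmap f ?w = vmap f ?x" using E by simp
    have sw: "scc ?w = scc ?x" by (rule scc_tail[OF eH])
    let ?s = "vhom f1 (scc ?x) (shift \<chi> e)"
    note sh = shift_closed[OF eH]
    have sh': "shift \<chi> (arev \<L> e) \<in> carrier (P ?x)" using shift_closed[OF r] e sw by simp
    have s: "?s \<in> carrier ?V" using sh by simp
    have mw: "m ?w \<in> carrier ?V" using m_closed[OF w] vw by simp
    have d': "delta f (arev \<L> e) \<in> carrier ?V" using delta_closed[of "arev \<L> e"] e vw by simp
    \<comment> \<open>The composite has \<delta> equal to \<open>?s\<close> on the collapsed edge;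
      \<open>k\<close> is what the required equation for \<delta> at e forces.\<close>
    define k where "k = inv\<^bsub>?V\<^esub> ?s \<otimes>\<^bsub>?V\<^esub> (m ?x \<otimes>\<^bsub>?V\<^esub> delta f e)"
    have k: "k \<in> carrier ?V" using s d m by (simp add: k_def)
    have ch: "chom (gog_comp \<L> \<G> f1 c) e h = k \<otimes>\<^bsub>?V\<^esub> chom f e h \<otimes>\<^bsub>?V\<^esub> inv\<^bsub>?V\<^esub> k"
      if h: "h \<in> carrier (egrp \<L> e)" for h
    proof -
      have hc: "chom f e h \<in> carrier ?V" using hom_in_carrier[OF E(4) h] E(1) by simp
      have "chom (gog_comp \<L> \<G> f1 c) e h =
          inv\<^bsub>?V\<^esub> ?s \<otimes>\<^bsub>?V\<^esub> vhom f1 (scc ?x) (vcls ?x (inc \<L> e h)) \<otimes>\<^bsub>?V\<^esub> ?s"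
        using eH sh vcls_closed[OF x inc_closed[OF e h]]
        by (simp add: gog_comp_def collapse_map_sel)
      also have "\<dots> = k \<otimes>\<^bsub>?V\<^esub> chom f e h \<otimes>\<^bsub>?V\<^esub> inv\<^bsub>?V\<^esub> k"
        unfolding descent_vcls[OF x inc_closed[OF e h]] E(6)[OF h] k_def
        using s d m hc by (simp add: E(1)[symmetric] V.m_assoc V.inv_mult_group)
      finally show ?thesis .
    qed
    have de: "delta (gog_comp \<L> \<G> f1 c) e = m ?x \<otimes>\<^bsub>?V\<^esub> delta f e \<otimes>\<^bsub>?V\<^esub> inv\<^bsub>?V\<^esub> k"
      using eH s d m by (simp add: gog_comp_def collapse_map_sel k_def V.inv_mult_group V.m_assoc
          V.inv_mult_cancel)
    have "delta (gog_comp \<L> \<G> f1 c) (arev \<L> e) = vhom f1 (scc ?x) (shift \<chi> (arev \<L> e))"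
      using r e sw by (simp add: gog_comp_def collapse_map_sel)
    \<comment> \<open>The same \<open>k\<close> must serve the reversed edge. It does, because the
      two shifts differ by the left factor \<open>ecls e\<close>, whose value is known from
      \<open>descent_ecls\<close>.\<close>
    also have "shift \<chi> (arev \<L> e) = ecls e \<otimes>\<^bsub>P ?x\<^esub> shift \<chi> e"
      using sh sh' by (simp flip: shift_arev[OF eH] add: Px.m_assoc)
    also have "vhom f1 (scc ?x) \<dots> = m ?w \<otimes>\<^bsub>?V\<^esub> delta f (arev \<L> e) \<otimes>\<^bsub>?V\<^esub> inv\<^bsub>?V\<^esub> k"
      using descent_ecls[OF eH] ecls_closed[OF eH] sh s d d' m mw
      by (simp add: k_def V.inv_mult_group V.m_assoc)
    finally have "delta (gog_comp \<L> \<G> f1 c) (arev \<L> e) =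
        m ?w \<otimes>\<^bsub>?V\<^esub> delta f (arev \<L> e) \<otimes>\<^bsub>?V\<^esub> inv\<^bsub>?V\<^esub> k" .
    then show ?thesis
      using Inr k ch de eH E(1) vmap_base[OF x] by (auto simp: Let_def comp_sel)
  qed
qed

sublocale D: noncollapsing_mor \<L>1 \<G> f1
  by (intro noncollapsing_mor.intro gog_mor.intro gog_mor_axioms.intro noncollapsing_mor_axioms.intro
      graph_of_groups_collapse G.graph_of_groups_axioms descent_morphism descent_no_edge)

text \<open>Composing with the collapse first or last gives the same morphism. The bracketings
  differ in \<delta> on surviving edges by the trivial element of the map onto the image, which is
  absorbed because the value it multiplies lies in the target group.\<close>

lemma same_morphism_factorization:
  "same_morphism \<L> (gog_comp \<L> \<G> f1 c)
    (gog_comp \<L> \<G> (image_inclusion f1) (gog_comp \<L> (image_gog \<L>1 \<G> f1) (onto_image \<L>1 \<G> f1) c))"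
  unfolding same_morphism_def
proof (intro conjI ballI)
  let ?c' = "gog_comp \<L> \<G> (image_inclusion f1) (gog_comp \<L> (image_gog \<L>1 \<G> f1) (onto_image \<L>1 \<G> f1) c)"
  fix e assume e: "e \<in> arcs (gr \<L>)"
  show em: "emap ?c' e = emap (gog_comp \<L> \<G> f1 c) e"
    by (simp add: gog_comp_def collapse_map_sel onto_image_def image_inclusion_def)
  let ?x = "head (gr \<L>) e"
  have x: "?x \<in> verts (gr \<L>)" using e by simp
  interpret V: group "vgrp \<G> (vmap f ?x)" by (rule group_target[OF x])
  have "\<one>\<^bsub>P ?x\<^esub> \<in> carrier (P ?x)" using group_P[OF x] by (simp add: group.is_monoid monoid.one_closed)
  then have "vhom f1 (scc ?x) \<one>\<^bsub>P ?x\<^esub> \<in> carrier (vgrp \<G> (vmap f ?x))"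
    using descent_vhom_hom[OF scc_in[OF x] scc_self[OF x]] by (rule hom_in_carrier[rotated])
  then show "delta ?c' e = delta (gog_comp \<L> \<G> f1 c) e"
    using vmap_base[OF x]
    by (simp add: gog_comp_def collapse_map_sel onto_image_def image_inclusion_def Let_def D.\<I>_sel
        \<L>1_sel descent_sel(1))
  show "if isl (emap (gog_comp \<L> \<G> f1 c) e) then ehom ?c' e h = ehom (gog_comp \<L> \<G> f1 c) e h
      else chom ?c' e h = chom (gog_comp \<L> \<G> f1 c) e h" if "h \<in> carrier (egrp \<L> e)" for h
    using e by (auto simp: gog_comp_def collapse_map_sel onto_image_def image_inclusion_def
        fibres_sel descent_sel)
qed (simp_all add: gog_comp_def collapse_map_sel onto_image_def image_inclusion_def)

end

text \<open>Existence of a choice is a separate conjunct so that the universal statement is not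
  vacuous. The factorization then holds for every system of base points, links and shifts, and the
  last conjunct assembles the stages into one composite.\<close>

theorem proposition2p2p1:
  fixes \<L> :: "('v, 'e, 'g, 'h) gog" and \<G> :: "('w, 'd, 'k, 'l) gog"
    and f :: "('v, 'e, 'g, 'h, 'w, 'd, 'k, 'l) gog_map"
  assumes "graph_of_groups \<L>" and "graph_of_groups \<G>" and "gog_morphism \<L> \<G> f"
  shows "(\<exists>\<chi>. is_collapse_choice \<L> (fibres \<L> \<G> f) \<chi>) \<and>
    (\<forall>\<chi>. is_collapse_choice \<L> (fibres \<L> \<G> f) \<chi> \<longrightarrow>
      (let H = fibres \<L> \<G> f;
           \<L>1 = collapse \<L> H \<chi>;
           c = collapse_map \<L> H \<chi>;
           f1 = fibre_descent \<L> \<G> f \<chi>;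
           \<L>2 = image_gog \<L>1 \<G> f1;
           q = onto_image \<L>1 \<G> f1;
           s = image_inclusion f1;
           m = (\<lambda>v. fibre_value \<L> \<G> f (base \<chi> (pre_digraph.scc_of H v)) (link \<chi> v))
       in graph_of_groups \<L>1 \<and> gog_morphism \<L> \<L>1 c \<and>
          gog_morphism \<L>1 \<G> f1 \<and> collapses_no_edge \<L>1 f1 \<and>
          conjugate_by \<L> \<G> m f (gog_comp \<L> \<G> f1 c) \<and>
          graph_of_groups \<L>2 \<and> gog_morphism \<L>1 \<L>2 q \<and>
          stallings \<L>2 \<G> s \<and>
          same_morphism \<L>1 f1 (gog_comp \<L>1 \<G> s q) \<and>
          conjugate_by \<L> \<G> m f (gog_comp \<L> \<G> s (gog_comp \<L> \<L>2 q c))))"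
proof (intro conjI allI impI, goal_cases)
  interpret M: gog_mor \<L> \<G> f
    using assms by (simp add: gog_mor_def gog_mor_axioms_def)
  {
    case 1
    show ?case by (rule M.collapse_choice_exists)
  next
    case (2 \<chi>)
    then interpret F: fibre_collapse \<L> \<G> f \<chi>
      by unfold_locales
    show ?case
      unfolding Let_def
      by (intro conjI F.graph_of_groups_collapse F.collapse_morphism F.descent_morphism
          F.descent_no_edge F.conjugate_by_collapse F.D.graph_of_groups_image
          F.D.onto_image_morphism F.D.image_inclusion_stallings F.D.image_factorization
          conjugate_by_same_morphism[OF assms(1) F.conjugate_by_collapse F.same_morphism_factorization])
  }
qed

end
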